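(* Let $B=\mathbb P^1_{\mathbb C}$ be equipped with its standard covering $\{U_1,U_2\}$, where $U_1=\mathrm{Spec}\,\mathbb C[t]$, $U_2=\mathrm{Spec}\,\mathbb C[t']$ and $t'=1/t$ on $U_1\cap U_2$. Then for any supermanifold $x=(\mathfrak U\to\mathfrak X)$, its Rothstein family $(R_i(x)\to U_i)_{i=1,2}$ (the Rothstein family associated to $x$, formed over each of $U_1$ and $U_2$) will glue to define a space over $\mathbb P^1_{\mathbb C}$.
   Context: Gluing: given a space $B$ with an open covering $(B_i)_{i\in I}$ and a collection of families $(X_i\to B_i)_{i\in I}$ of spaces or superspaces, we say $(X_i\to B_i)_{i\in I}$ will glue to define a space over $B$ if there exist $(\vartheta_{ij})_{i,j\in I}$ such that (i) on each non-empty intersection $B_i\cap B_j$, $\vartheta_{ij}:X_i|_{B_i\cap B_j}\to X_j|_{B_i\cap B_j}$ is an isomorphism over $B_i\cap B_j$, with $\vartheta_{ii}=\mathbf 1$ for all $i$; and (ii) on every non-empty triple intersection $B_i\cap B_j\cap B_k$, $\vartheta_{ik}=\vartheta_{jk}\circ\vartheta_{ij}$ over $B_i\cap B_j\cap B_k$. A model $(X,T^*_{X,-})$ is a complex manifold $X$ with a holomorphic vector bundle $T^*_{X,-}$. A supermanifold $(\mathfrak U\to\mathfrak X)$ modelled on $(X,T^*_{X,-})$ of splitting type $j>1$ is a 1-cocycle representative of a class in $\check H^1(X,\mathcal G^{(j)}_{T^*_{X,-}})$, where $\mathcal G^{(j)}_{T^*_{X,-}}$ is the sheaf of parity-preserving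 automorphisms of $\wedge^\bullet T^*_{X,-}$ that are the identity modulo $\bigoplus_{k\ge j}\wedge^kT^*_{X,-}$. Equivalently it is a locally ringed space $\mathfrak X$ with reduced space $X$ and structure sheaf locally isomorphic to $\wedge^\bullet T^*_{X,-}$, with a cover $(\mathfrak U_\alpha)$ by split pieces with even and odd coordinates, collectively denoted $(x|\theta)$ (here $x$ stands for the even coordinates), where open sets $\mathfrak U_{\alpha\beta}\subset\mathfrak U_\alpha$ are glued to $\mathfrak U_{\beta\alpha}\subset\mathfrak U_\beta$ by transition functions $$\rho_{\alpha\beta}(x|\theta)=f_{\alpha\beta}(x)+\zeta_{\alpha\beta}(x)\theta+h_{\alpha\beta}(x)\theta^j+O(\theta^{j+1}).$$ Here $f_{\alpha\beta}$ are the transition functions of $X$, $\zeta_{\alpha\beta}$ are those of $T^*_{X,-}$ (and $\zeta_{\alpha\beta}(x)\theta$ is linear in $\theta$), $h_{\alpha\beta}(x)\theta^j=\sum_{|I|=j}h^I_{\alpha\beta}(x)\theta_I$ over multi-indices $I$, and $O(\theta^{j+1})$ denotes terms proportional to $\theta^\ell$ with $\ell>j$. Rothstein family: modify $\rho$ by $x\mapsto x$, $\theta\mapsto\theta$, $\theta^j\mapsto t^j\theta^j$ for $t\in\mathbb C$, giving $$\vartheta_{\alpha\beta}(x,t|\theta)=f_{\alpha\beta}(x)+\zeta_{\alpha\beta}(x)\theta+t^jh_{\alpha\beta}(x)\theta^j+O(t^{j+1}\theta^{j+1}),$$ where the terms of $\rho_{\alpha\beta}$ of degree $k>j$ in $\theta$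 are correspondingly scaled by $t^k$. These glue $\mathfrak U_{\alpha\beta}\times\mathbb C\subset\mathcal U_\alpha$ to $\mathfrak U_{\beta\alpha}\times\mathbb C\subset\mathcal U_\beta$, where $\mathcal U_\alpha=\mathfrak U_\alpha\times\mathbb C$ and $t$ is a global coordinate on $\mathbb C$. With the cover $\mathcal U=(\mathcal U_\alpha)$, the resulting $\mathcal X$ and the projection $(x,t|\theta)\mapsto t$, this is the Rothstein family $(\mathcal U\to\mathcal X\to\mathbb C)$ associated to $(\mathfrak U\to\mathfrak X)$. $R_1(x)$ and $R_2(x)$ denote this family over $U_1\cong\mathbb C$ (coordinate $t$) and over $U_2\cong\mathbb C$ (coordinate $t'$ in place of $t$), respectively.
   Formalization: In the Rothstein family, terms of degree k in θ are scaled by t^k in the even components but by t^(k-1) in the odd components; scaling the odd components by t^k as well does not in general give transition functions satisfying the cocycle condition. *)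

theory Defs
  imports "HOL-Analysis.Analysis" "HOL-Algebra.QuotRing" "HOL-Algebra.Module"
begin

section \<open>Holomorphic functions of several variables\<close>

text \<open>
  Points of complex \<open>m\<close>-space are functions on the naturals that vanish from \<open>m\<close> on (as in
  \<^const>\<open>Euclidean_space\<close>), so that \<open>m = 0\<close> is allowed and adding one coordinate to \<open>z\<close> is the
  update \<open>z(m := t)\<close>.
\<close>

type_synonym cvec = "nat \<Rightarrow> complex"

definition Cn :: "nat \<Rightarrow> cvec set" where
  "Cn m = {z. \<forall>i\<ge>m. z i = 0}"

definition holo :: "nat \<Rightarrow> cvec set \<Rightarrow> (cvec \<Rightarrow> complex) \<Rightarrow> bool" where
  "holo m V f \<longleftrightarrow> continuous_on V f \<and>
     (\<forall>z\<in>V. \<forall>i<m. (\<lambda>w. f (z(i := w))) field_differentiable at (z i))"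

definition pd :: "nat \<Rightarrow> (cvec \<Rightarrow> complex) \<Rightarrow> cvec \<Rightarrow> complex" where
  "pd i f z = deriv (\<lambda>w. f (z(i := w))) (z i)"

definition mpd :: "nat \<Rightarrow> (nat \<Rightarrow> nat) \<Rightarrow> (cvec \<Rightarrow> complex) \<Rightarrow> cvec \<Rightarrow> complex" where
  "mpd m a f = foldr (\<lambda>i g. (pd i ^^ a i) g) [0..<m] f"


section \<open>Grassmann algebra and superfunctions\<close>

text \<open>
  An element of the exterior algebra on \<open>\<theta>\<^sub>0, \<dots>, \<theta>\<^sub>n\<^sub>-\<^sub>1\<close> is given by its
  coefficients: \<open>a J\<close> is the coefficient of the product of the \<open>\<theta>\<^sub>i\<close>, \<open>i \<in> J\<close>, in increasing
  order. A superfunction \<open>g(x|\<theta>)\<close> is a function of \<open>x\<close> with such values.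
\<close>

type_synonym grassmann = "nat set \<Rightarrow> complex"
type_synonym superfun = "cvec \<Rightarrow> grassmann"

definition gsign :: "nat set \<Rightarrow> nat set \<Rightarrow> complex" where
  "gsign K L = (- 1) ^ card {(k, l). k \<in> K \<and> l \<in> L \<and> l < k}"

definition gmult :: "grassmann \<Rightarrow> grassmann \<Rightarrow> grassmann" where
  "gmult a b = (\<lambda>J. \<Sum>K\<in>Pow J. gsign K (J - K) * a K * b (J - K))"

definition gone :: grassmann where
  "gone = (\<lambda>J. if J = {} then 1 else 0)"

definition gprod :: "grassmann list \<Rightarrow> grassmann" where
  "gprod as = foldr gmult as gone"

definition gpow :: "grassmann \<Rightarrow> nat \<Rightarrow> grassmann" where
  "gpow a k = gprod (replicate k a)"

definition superholo :: "nat \<Rightarrow> nat \<Rightarrow> cvec set \<Rightarrow> superfun \<Rightarrow> bool" where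
  "superholo m n V g \<longleftrightarrow>
     (\<forall>J. holo m V (\<lambda>z. g z J)) \<and> (\<forall>z\<in>V. \<forall>J. \<not> J \<subseteq> {..<n} \<longrightarrow> g z J = 0)"


section \<open>Maps of superdomains\<close>

text \<open>
  A map between superdomains of dimension \<open>m|n\<close> is given by the pullbacks \<open>evc F i\<close> (\<open>i < m\<close>)
  and \<open>odc F i\<close> (\<open>i < n\<close>) of the even and odd coordinates of the target.
\<close>

record supermap =
  evc :: "nat \<Rightarrow> superfun"
  odc :: "nat \<Rightarrow> superfun"

definition super_id :: supermap where
  "super_id = \<lparr> evc = (\<lambda>i z J. if J = {} then z i else 0),
                odc = (\<lambda>i z J. if J = {i} then 1 else 0) \<rparr>"

definition body :: "nat \<Rightarrow> supermap \<Rightarrow> cvec \<Rightarrow> cvec" where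
  "body m F z = (\<lambda>i. if i < m then evc F i z {} else 0)"

definition soul :: "supermap \<Rightarrow> cvec \<Rightarrow> nat \<Rightarrow> grassmann" where
  "soul F z i = (\<lambda>J. if J = {} then 0 else evc F i z J)"

text \<open>
  Substitution of a supermap into a superfunction: the Taylor expansion around the body, in powers
  of the nilpotent soul. The soul of an even coordinate has degree at least \<open>2\<close> in \<open>\<theta>\<close>, so
  its monomials of total degree above \<open>n\<close> vanish and the sum may be cut off there.
\<close>

definition multi_indices :: "nat \<Rightarrow> nat \<Rightarrow> (nat \<Rightarrow> nat) set" where
  "multi_indices m n = {a. (\<forall>i\<ge>m. a i = 0) \<and> (\<Sum>i<m. a i) \<le> n}"

definition pullback :: "nat \<Rightarrow> nat \<Rightarrow> supermap \<Rightarrow> superfun \<Rightarrow> superfun" where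
  "pullback m n F g z = (\<lambda>J. \<Sum>L\<in>Pow {..<n}. \<Sum>a\<in>multi_indices m n.
     mpd m a (\<lambda>y. g y L) (body m F z) / (\<Prod>i<m. fact (a i)) *
     gmult (gprod (map (\<lambda>i. gpow (soul F z i) (a i)) [0..<m]))
           (gprod (map (\<lambda>i. odc F i z) (sorted_list_of_set L))) J)"


section \<open>Models and supermanifolds\<close>

text \<open>
  A model is a complex manifold \<open>X\<close> (of pure dimension \<open>mdim\<close>) with a holomorphic vector bundle
  (of rank \<open>mrank\<close>), presented on an open cover of \<open>X\<close> by coordinate domains over which the
  bundle is trivialised, with transition matrices \<open>bdtrans \<alpha> \<beta>\<close>.
\<close>

record ('p, 'i) model =
  mspace :: "'p topology"
  mindex :: "'i set"
  patch :: "'i \<Rightarrow> 'p set"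
  chart :: "'i \<Rightarrow> 'p \<Rightarrow> cvec"
  mdim :: nat
  mrank :: nat
  bdtrans :: "'i \<Rightarrow> 'i \<Rightarrow> cvec \<Rightarrow> nat \<Rightarrow> nat \<Rightarrow> complex"

definition overlap :: "('p, 'i, 'z) model_scheme \<Rightarrow> 'i \<Rightarrow> 'i \<Rightarrow> cvec set" where
  "overlap M \<alpha> \<beta> = chart M \<alpha> ` (patch M \<alpha> \<inter> patch M \<beta>)"

definition transition :: "('p, 'i, 'z) model_scheme \<Rightarrow> 'i \<Rightarrow> 'i \<Rightarrow> cvec \<Rightarrow> cvec" where
  "transition M \<alpha> \<beta> z = chart M \<beta> (inv_into (patch M \<alpha>) (chart M \<alpha>) z)"

definition complex_manifold :: "('p, 'i, 'z) model_scheme \<Rightarrow> bool" where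
  "complex_manifold M \<longleftrightarrow>
     Hausdorff_space (mspace M) \<and> second_countable (mspace M) \<and>
     (\<forall>\<alpha>\<in>mindex M. openin (mspace M) (patch M \<alpha>)) \<and>
     (\<Union>\<alpha>\<in>mindex M. patch M \<alpha>) = topspace (mspace M) \<and>
     (\<forall>\<alpha>\<in>mindex M.
        openin (top_of_set (Cn (mdim M))) (chart M \<alpha> ` patch M \<alpha>) \<and>
        homeomorphic_map (subtopology (mspace M) (patch M \<alpha>))
          (top_of_set (chart M \<alpha> ` patch M \<alpha>)) (chart M \<alpha>)) \<and>
     (\<forall>\<alpha>\<in>mindex M. \<forall>\<beta>\<in>mindex M. \<forall>i<mdim M.
        holo (mdim M) (overlap M \<alpha> \<beta>) (\<lambda>z. transition M \<alpha> \<beta> z i))"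

definition holomorphic_bundle :: "('p, 'i, 'z) model_scheme \<Rightarrow> bool" where
  "holomorphic_bundle M \<longleftrightarrow>
     (\<forall>\<alpha>\<in>mindex M. \<forall>\<beta>\<in>mindex M. \<forall>i<mrank M. \<forall>k<mrank M.
        holo (mdim M) (overlap M \<alpha> \<beta>) (\<lambda>z. bdtrans M \<alpha> \<beta> z i k)) \<and>
     (\<forall>\<alpha>\<in>mindex M. \<forall>z\<in>overlap M \<alpha> \<alpha>. \<forall>i<mrank M. \<forall>k<mrank M.
        bdtrans M \<alpha> \<alpha> z i k = (if i = k then 1 else 0)) \<and>
     (\<forall>\<alpha>\<in>mindex M. \<forall>\<beta>\<in>mindex M. \<forall>\<gamma>\<in>mindex M.
        \<forall>z\<in>chart M \<alpha> ` (patch M \<alpha> \<inter> patch M \<beta> \<inter> patch M \<gamma>). \<forall>i<mrank M. \<forall>k<mrank M.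
        (\<Sum>l<mrank M. bdtrans M \<beta> \<gamma> (transition M \<alpha> \<beta> z) i l * bdtrans M \<alpha> \<beta> z l k) =
          bdtrans M \<alpha> \<gamma> z i k)"

definition is_model :: "('p, 'i, 'z) model_scheme \<Rightarrow> bool" where
  "is_model M \<longleftrightarrow> complex_manifold M \<and> holomorphic_bundle M"

record ('p, 'i) supermanifold = "('p, 'i) model" +
  rho :: "'i \<Rightarrow> 'i \<Rightarrow> supermap"

text \<open>
  The condition on \<open>\<rho>\<^sub>\<alpha>\<^sub>\<beta>\<close> over one overlap: it is parity preserving with reduced part
  the transition function of \<open>X\<close>, its part linear in \<open>\<theta>\<close> is that of the bundle, and
  otherwise only terms of degree at least \<open>j\<close> occur. This says that it differs from the
  transition of the exterior algebra of the bundle by an automorphism that is the identity modulo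
  degrees at least \<open>j\<close>.
\<close>

definition transition_of_type ::
  "nat \<Rightarrow> ('p, 'i, 'z) model_scheme \<Rightarrow> 'i \<Rightarrow> 'i \<Rightarrow> supermap \<Rightarrow> bool" where
  "transition_of_type j M \<alpha> \<beta> F \<longleftrightarrow>
     (\<forall>i<mdim M. superholo (mdim M) (mrank M) (overlap M \<alpha> \<beta>) (evc F i)) \<and>
     (\<forall>i<mrank M. superholo (mdim M) (mrank M) (overlap M \<alpha> \<beta>) (odc F i)) \<and>
     (\<forall>z\<in>overlap M \<alpha> \<beta>.
        (\<forall>i<mdim M. evc F i z {} = transition M \<alpha> \<beta> z i \<and>
           (\<forall>J. odd (card J) \<or> 0 < card J \<and> card J < j \<longrightarrow> evc F i z J = 0)) \<and>
        (\<forall>i<mrank M. (\<forall>k<mrank M. odc F i z {k} = bdtrans M \<alpha> \<beta> z i k) \<and>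
           (\<forall>J. even (card J) \<or> 1 < card J \<and> card J < j \<longrightarrow> odc F i z J = 0)))"

text \<open>
  The cocycle condition is \<open>\<rho>\<^sub>\<beta>\<^sub>\<gamma> \<circ> \<rho>\<^sub>\<alpha>\<^sub>\<beta> = \<rho>\<^sub>\<alpha>\<^sub>\<gamma>\<close> as maps from the \<open>\<alpha>\<close>-chart
  to the \<open>\<gamma>\<close>-chart, written in coordinates.
\<close>

definition is_supermanifold :: "nat \<Rightarrow> ('p, 'i, 'z) supermanifold_scheme \<Rightarrow> bool" where
  "is_supermanifold j S \<longleftrightarrow> is_model S \<and>
     (\<forall>\<alpha>\<in>mindex S. \<forall>\<beta>\<in>mindex S. transition_of_type j S \<alpha> \<beta> (rho S \<alpha> \<beta>)) \<and>
     (\<forall>\<alpha>\<in>mindex S. \<forall>z\<in>overlap S \<alpha> \<alpha>.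
        (\<forall>i<mdim S. evc (rho S \<alpha> \<alpha>) i z = evc super_id i z) \<and>
        (\<forall>i<mrank S. odc (rho S \<alpha> \<alpha>) i z = odc super_id i z)) \<and>
     (\<forall>\<alpha>\<in>mindex S. \<forall>\<beta>\<in>mindex S. \<forall>\<gamma>\<in>mindex S.
        \<forall>z\<in>chart S \<alpha> ` (patch S \<alpha> \<inter> patch S \<beta> \<inter> patch S \<gamma>).
        (\<forall>i<mdim S. pullback (mdim S) (mrank S) (rho S \<alpha> \<beta>) (evc (rho S \<beta> \<gamma>) i) z =
           evc (rho S \<alpha> \<gamma>) i z) \<and>
        (\<forall>i<mrank S. pullback (mdim S) (mrank S) (rho S \<alpha> \<beta>) (odc (rho S \<beta> \<gamma>) i) z =
           odc (rho S \<alpha> \<gamma>) i z))"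


section \<open>Spaces, superspaces and their morphisms\<close>

text \<open>
  A (super)space is a topological space with a sheaf of super-\<open>\<complex>\<close>-algebras; \<open>ssec S W\<close> is the
  algebra of sections over \<open>W\<close>, \<open>sres S W W'\<close> the restriction from \<open>W\<close> to \<open>W'\<close>, and
  \<open>seven S W\<close>, \<open>sodd S W\<close> the even and odd sections. Ordinary spaces are those whose only odd
  section is zero. The sheaf is only ever evaluated on open sets.
\<close>

record ('p, 's) superspace =
  stop :: "'p topology"
  ssec :: "'p set \<Rightarrow> (complex, 's) module"
  sres :: "'p set \<Rightarrow> 'p set \<Rightarrow> 's \<Rightarrow> 's"
  seven :: "'p set \<Rightarrow> 's set"
  sodd :: "'p set \<Rightarrow> 's set"

record ('p, 's, 'q, 't) smorph =
  smap :: "'p \<Rightarrow> 'q"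
  spull :: "'q set \<Rightarrow> 't \<Rightarrow> 's"

definition spre :: "('p, 's) superspace \<Rightarrow> ('p, 's, 'q, 't) smorph \<Rightarrow> 'q set \<Rightarrow> 'p set" where
  "spre S f V = {p \<in> topspace (stop S). smap f p \<in> V}"

definition is_morphism ::
  "('p, 's) superspace \<Rightarrow> ('q, 't) superspace \<Rightarrow> ('p, 's, 'q, 't) smorph \<Rightarrow> bool" where
  "is_morphism S T f \<longleftrightarrow>
     continuous_map (stop S) (stop T) (smap f) \<and>
     (\<forall>V. openin (stop T) V \<longrightarrow>
        spull f V \<in> ring_hom (ssec T V) (ssec S (spre S f V)) \<and>
        (\<forall>c. \<forall>s\<in>carrier (ssec T V).
           spull f V (c \<odot>\<^bsub>ssec T V\<^esub> s) = c \<odot>\<^bsub>ssec S (spre S f V)\<^esub> spull f V s) \<and>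
        spull f V ` seven T V \<subseteq> seven S (spre S f V) \<and>
        spull f V ` sodd T V \<subseteq> sodd S (spre S f V) \<and>
        (\<forall>V' s. openin (stop T) V' \<and> V' \<subseteq> V \<and> s \<in> carrier (ssec T V) \<longrightarrow>
           spull f V' (sres T V V' s) = sres S (spre S f V) (spre S f V') (spull f V s)))"

definition is_isomorphism ::
  "('p, 's) superspace \<Rightarrow> ('q, 't) superspace \<Rightarrow> ('p, 's, 'q, 't) smorph \<Rightarrow> bool" where
  "is_isomorphism S T f \<longleftrightarrow> is_morphism S T f \<and>
     homeomorphic_map (stop S) (stop T) (smap f) \<and>
     (\<forall>V. openin (stop T) V \<longrightarrow> spull f V \<in> ring_iso (ssec T V) (ssec S (spre S f V)))"

definition sid :: "('p, 's, 'p, 's) smorph" where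
  "sid = \<lparr> smap = id, spull = (\<lambda>V. id) \<rparr>"

text \<open>\<open>scomp T g f\<close> is the composite of \<open>f : S \<rightarrow> T\<close> followed by \<open>g : T \<rightarrow> R\<close>.\<close>

definition scomp ::
  "('q, 't) superspace \<Rightarrow> ('q, 't, 'r, 'u) smorph \<Rightarrow> ('p, 's, 'q, 't) smorph
     \<Rightarrow> ('p, 's, 'r, 'u) smorph" where
  "scomp T g f = \<lparr> smap = smap g \<circ> smap f, spull = (\<lambda>V. spull f (spre T g V) \<circ> spull g V) \<rparr>"

definition eq_morphism ::
  "('p, 's) superspace \<Rightarrow> ('q, 't) superspace \<Rightarrow> ('p, 's, 'q, 't) smorph
     \<Rightarrow> ('p, 's, 'q, 't) smorph \<Rightarrow> bool" where
  "eq_morphism S T f g \<longleftrightarrow>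
     (\<forall>p\<in>topspace (stop S). smap f p = smap g p) \<and>
     (\<forall>V. openin (stop T) V \<longrightarrow> (\<forall>s\<in>carrier (ssec T V). spull f V s = spull g V s))"

text \<open>
  For open \<open>A\<close>, the open subspace \<open>A\<close>; a morphism restricts to open subspaces without changing
  the underlying \<^typ>\<open>('p, 's, 'q, 't) smorph\<close>. For \<open>\<pi> : Y \<rightarrow> B\<close>, \<open>over Y \<pi> A\<close> is the
  restriction of \<open>Y\<close> to the part over the open set \<open>A\<close> of \<open>B\<close>.
\<close>

definition open_sub :: "('p, 's) superspace \<Rightarrow> 'p set \<Rightarrow> ('p, 's) superspace" where
  "open_sub S A = S\<lparr> stop := subtopology (stop S) A \<rparr>"

definition over ::
  "('p, 's) superspace \<Rightarrow> ('p, 's, 'b, 't) smorph \<Rightarrow> 'b set \<Rightarrow> ('p, 's) superspace" where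
  "over Y \<pi> A = open_sub Y (spre Y \<pi> A)"

definition iso_over ::
  "('b, 't) superspace \<Rightarrow> 'b set
     \<Rightarrow> ('p, 's) superspace \<Rightarrow> ('p, 's, 'b, 't) smorph
     \<Rightarrow> ('q, 'u) superspace \<Rightarrow> ('q, 'u, 'b, 't) smorph \<Rightarrow> ('p, 's, 'q, 'u) smorph \<Rightarrow> bool" where
  "iso_over B A Y \<pi> Z \<psi> f \<longleftrightarrow>
     is_isomorphism (over Y \<pi> A) (over Z \<psi> A) f \<and>
     eq_morphism (over Y \<pi> A) (open_sub B A) (scomp (over Z \<psi> A) \<psi> f) \<pi>"

definition will_glue ::
  "('b, 't) superspace \<Rightarrow> 'k set \<Rightarrow> ('k \<Rightarrow> 'b set)
     \<Rightarrow> ('k \<Rightarrow> ('p, 's) superspace) \<Rightarrow> ('k \<Rightarrow> ('p, 's, 'b, 't) smorph) \<Rightarrow> bool" where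
  "will_glue B K Bs Xs \<pi>s \<longleftrightarrow>
     (\<forall>i\<in>K. openin (stop B) (Bs i)) \<and> (\<Union>i\<in>K. Bs i) = topspace (stop B) \<and>
     (\<forall>i\<in>K. is_morphism (Xs i) (open_sub B (Bs i)) (\<pi>s i)) \<and>
     (\<exists>\<theta> :: 'k \<Rightarrow> 'k \<Rightarrow> ('p, 's, 'p, 's) smorph.
        (\<forall>i\<in>K. \<forall>j\<in>K. Bs i \<inter> Bs j \<noteq> {} \<longrightarrow>
           iso_over B (Bs i \<inter> Bs j) (Xs i) (\<pi>s i) (Xs j) (\<pi>s j) (\<theta> i j)) \<and>
        (\<forall>i\<in>K. eq_morphism (Xs i) (Xs i) (\<theta> i i) sid) \<and>
        (\<forall>i\<in>K. \<forall>j\<in>K. \<forall>k\<in>K. Bs i \<inter> Bs j \<inter> Bs k \<noteq> {} \<longrightarrow>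
           eq_morphism (over (Xs i) (\<pi>s i) (Bs i \<inter> Bs j \<inter> Bs k))
             (over (Xs k) (\<pi>s k) (Bs i \<inter> Bs j \<inter> Bs k))
             (\<theta> i k)
             (scomp (over (Xs j) (\<pi>s j) (Bs i \<inter> Bs j \<inter> Bs k)) (\<theta> j k) (\<theta> i j))))"


section \<open>The affine and the projective line\<close>

definition fun_alg :: "('p \<Rightarrow> complex) set \<Rightarrow> 'p set \<Rightarrow> (complex, 'p \<Rightarrow> complex) module" where
  "fun_alg F W =
     \<lparr> carrier = F, monoid.mult = (\<lambda>f g x. f x * g x), one = (\<lambda>x. if x \<in> W then 1 else 0),
       zero = (\<lambda>x. 0), add = (\<lambda>f g x. f x + g x), smult = (\<lambda>c f x. c * f x) \<rparr>"

text \<open>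
  The space with underlying topology \<open>T\<close> whose functions on \<open>W\<close> are \<open>F W\<close>; functions on \<open>W\<close> are
  taken to be \<open>0\<close> outside \<open>W\<close>.
\<close>

definition function_space ::
  "'p topology \<Rightarrow> ('p set \<Rightarrow> ('p \<Rightarrow> complex) set) \<Rightarrow> ('p, 'p \<Rightarrow> complex) superspace" where
  "function_space T F =
     \<lparr> stop = T, ssec = (\<lambda>W. fun_alg (F W) W),
       sres = (\<lambda>W W' f x. if x \<in> W' then f x else 0),
       seven = F, sodd = (\<lambda>W. {\<lambda>x. 0}) \<rparr>"

definition affine_line :: "(complex, complex \<Rightarrow> complex) superspace" where
  "affine_line = function_space euclidean
     (\<lambda>W. {f. f holomorphic_on W \<and> (\<forall>t. t \<notin> W \<longrightarrow> f t = 0)})"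

text \<open>Points of the projective line are classes \<open>[a : b]\<close> of nonzero vectors up to scaling.\<close>

definition hpoint :: "complex \<Rightarrow> complex \<Rightarrow> (complex \<times> complex) set" where
  "hpoint a b = {(c * a, c * b) | c. c \<noteq> 0}"

definition P1_points :: "(complex \<times> complex) set set" where
  "P1_points = {hpoint a b | a b. (a, b) \<noteq> (0, 0)}"

text \<open>
  The coordinates \<open>t\<close> on \<open>U\<^sub>1\<close> and \<open>t'\<close> on \<open>U\<^sub>2\<close>, as parametrisations \<open>t \<mapsto> [1 : t]\<close>
  and \<open>t' \<mapsto> [t' : 1]\<close>, so that \<open>t' = 1/t\<close> on the overlap.
\<close>

definition P1_param :: "nat \<Rightarrow> complex \<Rightarrow> (complex \<times> complex) set" where
  "P1_param i t = (if i = 1 then hpoint 1 t else hpoint t 1)"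

definition P1_patch :: "nat \<Rightarrow> (complex \<times> complex) set set" where
  "P1_patch i = range (P1_param i)"

definition P1_open :: "(complex \<times> complex) set set \<Rightarrow> bool" where
  "P1_open W \<longleftrightarrow> W \<subseteq> P1_points \<and> (\<forall>i\<in>{1, 2}. open (P1_param i -` W))"

lemma istopology_P1_open: "istopology P1_open"
  unfolding istopology_def P1_open_def
  by (auto simp: vimage_Union intro!: open_Int open_UN)

definition P1 :: "((complex \<times> complex) set, (complex \<times> complex) set \<Rightarrow> complex) superspace" where
  "P1 = function_space (topology P1_open)
     (\<lambda>W. {g. (\<forall>i\<in>{1, 2}. (g \<circ> P1_param i) holomorphic_on (P1_param i -` W)) \<and>
              (\<forall>p. p \<notin> W \<longrightarrow> g p = 0)})"

definition P1_incl ::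
  "nat \<Rightarrow> (complex, complex \<Rightarrow> complex,
            (complex \<times> complex) set, (complex \<times> complex) set \<Rightarrow> complex) smorph" where
  "P1_incl i = \<lparr> smap = P1_param i, spull = (\<lambda>V g. g \<circ> P1_param i) \<rparr>"


section \<open>The Rothstein family\<close>

text \<open>
  The coordinate \<open>t\<close> is the last of the \<open>m + 1\<close> even coordinates. The \<open>\<theta>\<close>-degree
  \<open>k\<close> part of an even component is scaled by \<open>t\<^sup>k\<close>. In the odd components the scaling has to be
  normalised so that the linear part is unchanged, and their degree \<open>k\<close> part is scaled by the
  power \<open>k - 1\<close> of \<open>t\<close>. In both cases the exponent is the amount by which the term, as an operator
  on the exterior algebra, raises the degree; for \<open>t \<noteq> 0\<close> the result is the conjugate of the
  original transition by \<open>(x|\<theta>) \<mapsto> (x|t\<theta>)\<close>. With the power \<open>k\<close> in the odd components as well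
  the cocycle condition would be lost.
\<close>

definition rothstein_transition :: "nat \<Rightarrow> supermap \<Rightarrow> supermap" where
  "rothstein_transition m F =
     \<lparr> evc = (\<lambda>i z J. if i < m then z m ^ card J * evc F i (z(m := 0)) J
                      else if J = {} then z i else 0),
       odc = (\<lambda>i z J. z m ^ (card J - 1) * odc F i (z(m := 0)) J) \<rparr>"

type_synonym 'i sections = "'i \<Rightarrow> superfun"

text \<open>The image in the coordinates \<open>(x, t)\<close> of the part of \<open>W\<close> that lies over the patch \<open>\<alpha>\<close>.\<close>

definition coords ::
  "('p, 'i, 'z) model_scheme \<Rightarrow> 'i \<Rightarrow> ('p \<times> complex) set \<Rightarrow> cvec set" where
  "coords S \<alpha> W = {(chart S \<alpha> p)(mdim S := t) | p t. (p, t) \<in> W \<and> p \<in> patch S \<alpha>}"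

text \<open>
  As the transition functions of \<open>X\<close> are not deformed, the pieces \<open>U\<^sub>\<alpha> \<times> \<complex>\<close> glue to the
  topological space \<open>X \<times> \<complex>\<close>. A section of the glued sheaf is a family of superfunctions on the
  pieces that correspond to each other under the transitions.
\<close>

definition rothstein_sections ::
  "('p, 'i, 'z) supermanifold_scheme \<Rightarrow> ('p \<times> complex) set \<Rightarrow> 'i sections set" where
  "rothstein_sections S W =
     {s. (\<forall>\<alpha>\<in>mindex S. superholo (Suc (mdim S)) (mrank S) (coords S \<alpha> W) (s \<alpha>)) \<and>
         (\<forall>\<alpha> z J. \<alpha> \<notin> mindex S \<or> z \<notin> coords S \<alpha> W \<longrightarrow> s \<alpha> z J = 0) \<and>
         (\<forall>\<alpha>\<in>mindex S. \<forall>\<beta>\<in>mindex S. \<forall>z\<in>coords S \<alpha> (W \<inter> patch S \<beta> \<times> UNIV).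
            s \<alpha> z = pullback (Suc (mdim S)) (mrank S)
              (rothstein_transition (mdim S) (rho S \<alpha> \<beta>)) (s \<beta>) z)}"

definition rothstein_scalar ::
  "('p, 'i, 'z) supermanifold_scheme \<Rightarrow> ('p \<times> complex) set \<Rightarrow> (complex \<Rightarrow> complex)
     \<Rightarrow> 'i sections" where
  "rothstein_scalar S W g = (\<lambda>\<alpha> z J.
     if \<alpha> \<in> mindex S \<and> z \<in> coords S \<alpha> W \<and> J = {} then g (z (mdim S)) else 0)"

definition rothstein_alg ::
  "('p, 'i, 'z) supermanifold_scheme \<Rightarrow> ('p \<times> complex) set \<Rightarrow> (complex, 'i sections) module" where
  "rothstein_alg S W =
     \<lparr> carrier = rothstein_sections S W,
       monoid.mult = (\<lambda>s s' \<alpha> z. gmult (s \<alpha> z) (s' \<alpha> z)),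
       one = rothstein_scalar S W (\<lambda>t. 1),
       zero = (\<lambda>\<alpha> z J. 0),
       add = (\<lambda>s s' \<alpha> z J. s \<alpha> z J + s' \<alpha> z J),
       smult = (\<lambda>c s \<alpha> z J. c * s \<alpha> z J) \<rparr>"

definition rothstein_space ::
  "('p, 'i, 'z) supermanifold_scheme \<Rightarrow> ('p \<times> complex, 'i sections) superspace" where
  "rothstein_space S =
     \<lparr> stop = prod_topology (mspace S) euclidean,
       ssec = rothstein_alg S,
       sres = (\<lambda>W W' s \<alpha> z J. if z \<in> coords S \<alpha> W' then s \<alpha> z J else 0),
       seven = (\<lambda>W. {s \<in> rothstein_sections S W. \<forall>\<alpha> z J. odd (card J) \<longrightarrow> s \<alpha> z J = 0}),
       sodd = (\<lambda>W. {s \<in> rothstein_sections S W. \<forall>\<alpha> z J. even (card J) \<longrightarrow> s \<alpha> z J = 0}) \<rparr>"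

definition rothstein_proj ::
  "('p, 'i, 'z) supermanifold_scheme
     \<Rightarrow> ('p \<times> complex, 'i sections, complex, complex \<Rightarrow> complex) smorph" where
  "rothstein_proj S =
     \<lparr> smap = snd, spull = (\<lambda>V. rothstein_scalar S (topspace (mspace S) \<times> V)) \<rparr>"

text \<open>The Rothstein family over \<open>U\<^sub>i\<close>, with the base identified with \<open>\<complex>\<close> by its coordinate.\<close>

definition rothstein_over ::
  "('p, 'i, 'z) supermanifold_scheme \<Rightarrow> nat
     \<Rightarrow> ('p \<times> complex, 'i sections,
         (complex \<times> complex) set, (complex \<times> complex) set \<Rightarrow> complex) smorph" where
  "rothstein_over S i = scomp affine_line (P1_incl i) (rothstein_proj S)"

end

theory Submission
  imports Defs "HOL-Complex_Analysis.Cauchy_Integral_Formula"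
begin

text \<open>
  For \<open>t \<noteq> 0\<close> the fibre of the Rothstein family over \<open>t\<close> is obtained from the given
  supermanifold by conjugating its transitions with \<open>(x|\<theta>) \<mapsto> (x|t\<theta>)\<close>. Hence
  \<open>(x, t|\<theta>) \<mapsto> (x, 1/t|t\<^sup>2\<theta>)\<close> commutes with the transitions of the family and defines an
  involution of its restriction to \<open>t \<noteq> 0\<close>, lying over \<open>t \<mapsto> 1/t\<close>. With only two sets in the
  cover, the involution property is the whole cocycle condition.
\<close>

section \<open>Partial derivatives of holomorphic functions\<close>

text \<open>The factor \<open>t^2\<close> is a quotient of two scalings. The map (x|t theta) carries
  the fibre over \<open>t\<close> to the given supermanifold, and passing on to the fibre over
  \<open>1/t\<close> undoes a scaling by \<open>1/t\<close>, so theta is multiplied by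
  \<open>t\<close> twice. The obstacle is that composition with a transition is the explicit Taylor
  sum \<open>pullback\<close>. The commutation is therefore checked summand by summand. Three things
  make the summands match. The parameter has no nilpotent part, so summands with a
  \<open>t\<close>-derivative vanish and the substitution of \<open>1/t\<close> is never
  differentiated in the sum. Derivatives in x treat \<open>t\<close> as a constant. The factor that
  the substitution puts on the coefficient of a monomial in theta is cancelled by the factors that
  the odd components of the transition produce. Since \<open>holo\<close> demands only continuity
  and separate differentiability, repeated derivatives in x are tractable only once partial
  derivatives are known to be \<open>holo\<close> again; this is where complex analysis
  enters.\<close>

lemma continuous_on_fun_upd [continuous_intros]:
  fixes f :: "'a::topological_space \<Rightarrow> 'b \<Rightarrow> 'c::topological_space"
  assumes "continuous_on S f" "continuous_on S g"
  shows "continuous_on S (\<lambda>x. (f x)(i := g x))"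
proof (rule continuous_on_coordinatewise_then_product)
  fix k show "continuous_on S (\<lambda>x. ((f x)(i := g x)) k)"
    using assms by (cases "k = i") (auto intro: continuous_on_product_then_coordinatewise)
qed

lemma continuous_on_nth: "continuous_on S (\<lambda>z :: 'a \<Rightarrow> 'b::topological_space. z i)"
  by (rule continuous_on_subset[OF continuous_on_product_coordinates]) simp

section \<open>Polydiscs as neighbourhoods in \<open>Cn m\<close>\<close>

definition polydisc :: "nat \<Rightarrow> cvec \<Rightarrow> real \<Rightarrow> cvec set" where
  "polydisc m z0 r = {z \<in> Cn m. \<forall>k<m. dist (z0 k) (z k) < r}"

lemma polydisc_open_ext:
  "\<exists>U. open U \<and> polydisc m z0 r = Cn m \<inter> U"
proof -
  have "open {z. \<forall>k\<in>{..<m}. z k \<in> ball (z0 k) r}"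
    by (rule product_topology_basis'[where x = "\<lambda>k. k"]) auto
  moreover have "polydisc m z0 r = Cn m \<inter> {z. \<forall>k\<in>{..<m}. z k \<in> ball (z0 k) r}"
    by (auto simp: polydisc_def)
  ultimately show ?thesis by blast
qed

lemma polydisc_upd:
  assumes "z \<in> polydisc m z0 r" "dist (z0 i) w < r" "i < m"
  shows "z(i := w) \<in> polydisc m z0 r"
  using assms by (auto simp: polydisc_def Cn_def)

text \<open>A basic open box of the product topology constrains the coordinates separately. Those
  below \<open>m\<close> get a common radius, and the remaining ones agree because all points of
  \<open>Cn m\<close> vanish there.\<close>

lemma openin_Cn_polydisc:
  assumes "openin (top_of_set (Cn m)) V" "z0 \<in> V"
  obtains r where "r > 0" "polydisc m z0 r \<subseteq> V"
proof -
  obtain U where U: "open U" "V = Cn m \<inter> U"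
    using assms(1) by (auto simp: openin_open)
  have "openin (product_topology (\<lambda>i. euclidean) UNIV) U" "z0 \<in> U"
    using U assms(2) by (auto simp: open_fun_def)
  from product_topology_open_contains_basis[OF this]
  obtain X where X: "z0 \<in> Pi\<^sub>E UNIV X" "\<And>i. open (X i)" "Pi\<^sub>E UNIV X \<subseteq> U" by auto
  have "\<exists>r>0. ball (z0 k) r \<subseteq> X k" for k
    using X(1,2) by (meson UNIV_I PiE_mem open_contains_ball)
  then obtain r where r: "\<And>k. r k > 0" "\<And>k. ball (z0 k) (r k) \<subseteq> X k" by metis
  \<comment> \<open>The element 1 keeps the minimum meaningful when \<open>m = 0\<close>.\<close>
  define R where "R = Min (insert 1 (r ` {..<m}))"
  have R: "R > 0" "\<And>k. k < m \<Longrightarrow> R \<le> r k"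
    using r by (auto simp: R_def)
  have "polydisc m z0 R \<subseteq> V"
  proof
    fix z assume z: "z \<in> polydisc m z0 R"
    have "z k \<in> X k" for k
    proof (cases "k < m")
      case True
      then have "dist (z0 k) (z k) < r k"
        using z R(2)[OF True] by (fastforce simp: polydisc_def)
      then show ?thesis using r(2)[of k] by auto
    next
      case False
      then have "z k = z0 k"
        using z U assms(2) by (auto simp: polydisc_def Cn_def)
      then show ?thesis using X(1) by auto
    qed
    then show "z \<in> V" using X(3) z U by (auto simp: polydisc_def)
  qed
  with R(1) that show ?thesis by blast
qed

text \<open>Functions are usually known to agree only on \<open>V\<close>. That slices stay in
  \<open>V\<close> near the point is what \<open>deriv_cong_ev\<close> requires to compare their
  partial derivatives.\<close>

lemma eventually_upd_in_openin:
  assumes "openin (top_of_set (Cn m)) V" "z \<in> V" "i < m"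
  shows "\<forall>\<^sub>F w in nhds (z i). z(i := w) \<in> V"
proof -
  obtain r where r: "r > 0" "polydisc m z r \<subseteq> V"
    using openin_Cn_polydisc[OF assms(1,2)] .
  have z: "z \<in> polydisc m z r"
    using assms(1,2) r(1) by (auto simp: polydisc_def openin_open)
  have "\<forall>\<^sub>F w in nhds (z i). w \<in> ball (z i) r"
    using r(1) by (intro eventually_nhds_in_open) auto
  then show ?thesis
    by eventually_elim (use polydisc_upd[OF z _ assms(3)] r(2) in auto)
qed

lemma continuous_on_openin_locally:
  fixes f :: "'a::t2_space \<Rightarrow> 'b::topological_space"
  assumes "\<And>z. z \<in> V \<Longrightarrow> \<exists>W. openin (top_of_set V) W \<and> z \<in> W \<and> continuous_on W f"
  shows "continuous_on V f"
  unfolding continuous_on_eq_continuous_within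
proof (intro ballI)
  fix z assume z: "z \<in> V"
  obtain W where W: "openin (top_of_set V) W" "z \<in> W" "continuous_on W f"
    using assms[OF z] by blast
  then obtain U where U: "open U" "W = V \<inter> U" by (auto simp: openin_open)
  have "continuous (at z within W) f"
    using W by (auto simp: continuous_on_eq_continuous_within)
  moreover have "at z within W = at z within V"
    by (rule at_within_nhd[of z U]) (use U W in auto)
  ultimately show "continuous (at z within V) f" by simp
qed

section \<open>Cauchy estimates and locally uniform difference quotients\<close>

lemma Taylor_quotient_bound:
  assumes g: "g holomorphic_on ball a (2 * r)" and r: "r > 0"
    and B: "\<And>w. w \<in> ball a (2 * r) \<Longrightarrow> norm (g w) < B"
    and h: "h \<noteq> 0" "norm h < r / 2"
  shows "norm ((g (a + h) - g a) / h - deriv g a) \<le> (8 * B / r ^ 2) * norm h"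
proof -
  define f where "f = (\<lambda>k. (deriv ^^ k) g)"
  have hol: "f k holomorphic_on ball a (2 * r)" for k
    unfolding f_def by (intro holomorphic_higher_deriv g) auto
  have der: "(f k has_field_derivative f (Suc k) x) (at x within ball a (r/2))"
    if "x \<in> ball a (r/2)" for k x
    using holomorphic_derivI[OF hol[of k], of x "ball a (r/2)"] that r by (auto simp: f_def)
  \<comment> \<open>Discs of radius \<open>r/2\<close> about points of the \<open>r/2\<close>-disc
    stay inside the \<open>2r\<close>-disc, where \<open>B\<close> bounds \<open>g\<close>. Cauchy's
    estimate for the second derivative then reads 2! B / (r/2)^2, whence the constant 8.\<close>
  have bnd: "norm (f 2 x) \<le> 8 * B / r ^ 2" if x: "x \<in> ball a (r/2)" for x
  proof -
    have sub: "cball x (r/2) \<subseteq> ball a (2 * r)"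
    proof
      fix y assume "y \<in> cball x (r/2)"
      then show "y \<in> ball a (2 * r)" using x r dist_triangle[of a y x] by auto
    qed
    have "norm ((deriv ^^ 2) g x) \<le> fact 2 * B / (r/2) ^ 2"
    proof (rule Cauchy_higher_deriv_bound[where y = 0])
      show "g holomorphic_on ball x (r/2)"
        by (rule holomorphic_on_subset[OF g]) (use sub in auto)
      show "continuous_on (cball x (r/2)) g"
        by (intro holomorphic_on_imp_continuous_on holomorphic_on_subset[OF g] sub)
      show "g w \<in> ball 0 B" if "w \<in> ball x (r/2)" for w
        using B[of w] sub that by (auto simp: subset_iff)
    qed (use r in auto)
    also have "fact 2 * B / (r/2) ^ 2 = 8 * B / r ^ 2"
      using r by (simp add: field_simps power2_eq_square)
    finally show ?thesis by (simp add: f_def)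
  qed
  have "norm (f 0 (a + h) - (\<Sum>i\<le>1. f i a * (a + h - a) ^ i / fact i))
          \<le> (8 * B / r ^ 2) * norm (a + h - a) ^ Suc 1 / fact 1"
    by (rule complex_Taylor[of "ball a (r/2)" 1])
       (use der bnd h r in \<open>auto simp: dist_norm numeral_2_eq_2\<close>)
  then have *: "norm (g (a + h) - g a - deriv g a * h) \<le> (8 * B / r ^ 2) * norm h ^ 2"
    by (simp add: f_def numeral_2_eq_2 algebra_simps)
  have "norm ((g (a + h) - g a) / h - deriv g a) = norm ((g (a + h) - g a - deriv g a * h) / h)"
    using h by (simp add: field_simps)
  also have "\<dots> = norm (g (a + h) - g a - deriv g a * h) / norm h"
    by (simp add: norm_divide)
  also have "\<dots> \<le> ((8 * B / r ^ 2) * norm h ^ 2) / norm h"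
    using * h by (intro divide_right_mono) auto
  also have "\<dots> = (8 * B / r ^ 2) * norm h"
    using h by (simp add: power2_eq_square)
  finally show ?thesis .
qed

lemma holo_field_differentiable:
  assumes "holo m V f" "z \<in> V" "i < m"
  shows "(\<lambda>w. f (z(i := w))) field_differentiable at (z i)"
  using assms by (auto simp: holo_def)

lemma holo_field_differentiable':
  assumes "holo m V f" "z(i := a) \<in> V" "i < m"
  shows "(\<lambda>w. f (z(i := w))) field_differentiable at a"
  using holo_field_differentiable[OF assms] by simp

lemma continuous_on_holo:
  "holo m V f \<Longrightarrow> continuous_on V f"
  by (simp add: holo_def)

lemma holo_bounded_locally:
  assumes V: "openin (top_of_set (Cn m)) V" and f: "continuous_on V f" and z0: "z0 \<in> V"
  obtains r B where "r > 0" "polydisc m z0 r \<subseteq> V"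
    "\<And>z. z \<in> polydisc m z0 r \<Longrightarrow> norm (f z :: complex) < B"
proof -
  have "openin (top_of_set V) {z \<in> V. f z \<in> ball (f z0) 1}"
    using f by (auto simp: continuous_on_open_gen[of f V UNIV] vimage_def Int_def
        dest!: spec[of _ "ball (f z0) 1"])
  then have "openin (top_of_set (Cn m)) {z \<in> V. f z \<in> ball (f z0) 1}"
    using V by (rule openin_trans)
  moreover have "z0 \<in> {z \<in> V. f z \<in> ball (f z0) 1}" using z0 by simp
  ultimately obtain r where r: "r > 0" "polydisc m z0 r \<subseteq> {z \<in> V. f z \<in> ball (f z0) 1}"
    by (rule openin_Cn_polydisc)
  have "norm (f z) < norm (f z0) + 1" if "z \<in> polydisc m z0 r" for z
  proof -
    have "dist (f z0) (f z) < 1" using r(2) that by auto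
    then show ?thesis using norm_triangle_ineq2[of "f z" "f z0"]
      by (simp add: dist_norm norm_minus_commute)
  qed
  with r that show ?thesis by blast
qed

text \<open>The constant in \<open>Taylor_quotient_bound\<close> involves only \<open>B\<close> and
  \<open>r\<close>, not the centre. One bound for \<open>f\<close> on a larger polydisc thus
  controls the difference quotients at all points of the smaller one at the same rate, and the
  quotients inherit continuity and separate differentiability from \<open>f\<close>.\<close>

lemma pd_uniform_limit:
  assumes V: "openin (top_of_set (Cn m)) V" and f: "holo m V f" and i: "i < m" and z0: "z0 \<in> V"
  obtains r q where "r > 0" "polydisc m z0 r \<subseteq> V"
    "\<And>n. continuous_on (polydisc m z0 r) (q n)"
    "\<And>n z k. z \<in> polydisc m z0 r \<Longrightarrow> k < m \<Longrightarrow>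
       (\<lambda>w. q n (z(k := w))) field_differentiable at (z k)"
    "uniform_limit (polydisc m z0 r) q (pd i f) sequentially"
proof -
  obtain R B where R: "R > 0" and RV: "polydisc m z0 R \<subseteq> V"
    and B: "\<And>z. z \<in> polydisc m z0 R \<Longrightarrow> norm (f z) < B"
    using holo_bounded_locally[OF V continuous_on_holo[OF f] z0] by metis
  \<comment> \<open>A disc of radius \<open>2r\<close> about the \<open>i\<close>-th coordinate of a
    point of the \<open>r\<close>-polydisc stays within \<open>3r < R\<close> of the centre.\<close>
  define r where "r = R / 4"
  \<comment> \<open>The summand 3 makes the steps at most \<open>r/3\<close>, hence smaller than
    \<open>r/2\<close>, already for \<open>n = 0\<close>.\<close>
  define h where "h n = complex_of_real (r / (real n + 3))" for n :: nat
  have r: "r > 0" using R by (simp add: r_def)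
  have h: "h n \<noteq> 0" "norm (h n) < r / 2" for n
  proof -
    show "h n \<noteq> 0" using r unfolding h_def of_real_eq_0_iff by simp
    have "norm (h n) = r / (real n + 3)"
      using r unfolding h_def norm_of_real by simp
    also have "\<dots> \<le> r / 3" using r by (intro divide_left_mono) auto
    also have "\<dots> < r / 2" using r by simp
    finally show "norm (h n) < r / 2" .
  qed
  have hlim: "h \<longlonglongrightarrow> 0"
  proof -
    have "(\<lambda>n. r / (real n + 3)) \<longlonglongrightarrow> 0"
      by (intro real_tendsto_divide_at_top[OF tendsto_const]
          filterlim_at_top_add_at_top filterlim_real_sequentially tendsto_const
          filterlim_tendsto_add_at_top[OF tendsto_const, of _ _ 3, simplified add.commute])
    from tendsto_of_real[OF this, where ?'a = complex] show ?thesis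
      unfolding h_def by simp
  qed
  have sub: "polydisc m z0 r \<subseteq> polydisc m z0 R"
    using R by (auto simp: polydisc_def r_def)
  have in_big: "z(i := w) \<in> polydisc m z0 R"
    if "z \<in> polydisc m z0 r" "dist (z i) w < 2 * r" for z w
  proof (rule polydisc_upd[OF _ _ i])
    show "z \<in> polydisc m z0 R" using that sub by blast
    have "dist (z0 i) (z i) < r" using that i by (auto simp: polydisc_def)
    then show "dist (z0 i) w < R"
      using that(2) dist_triangle[of "z0 i" w "z i"] R by (simp add: r_def)
  qed
  have in_shift: "z(i := z i + h n) \<in> polydisc m z0 R" if "z \<in> polydisc m z0 r" for z n
    using in_big[OF that, of "z i + h n"] h(2)[of n] r by (simp add: dist_norm)
  define q where "q n z = (f (z(i := z i + h n)) - f z) / h n" for n z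
  show ?thesis
  proof (rule that[of r q])
    show "r > 0" by fact
    show "polydisc m z0 r \<subseteq> V" using sub RV by blast
    show "continuous_on (polydisc m z0 r) (q n)" for n
    proof -
      have "continuous_on (polydisc m z0 r) (\<lambda>z. f (z(i := z i + h n)))"
      proof (rule continuous_on_compose2[OF continuous_on_holo[OF f]])
        show "continuous_on (polydisc m z0 r) (\<lambda>z. z(i := z i + h n))"
          by (intro continuous_intros continuous_on_nth)
      qed (use in_shift RV in auto)
      moreover have "continuous_on (polydisc m z0 r) f"
        by (rule continuous_on_subset[OF continuous_on_holo[OF f]]) (use sub RV in auto)
      ultimately show ?thesis
        unfolding q_def using h by (intro continuous_intros) auto
    qed
    show "(\<lambda>w. q n (z(k := w))) field_differentiable at (z k)"
      if z: "z \<in> polydisc m z0 r" and k: "k < m" for n z k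
    proof -
      have 1: "(\<lambda>w. f (z(k := w))) field_differentiable at (z k)"
        using holo_field_differentiable[OF f _ k] z sub RV by blast
      \<comment> \<open>For \<open>k = i\<close> the shift moves along with the variable, which is a
        composition with a translation. Otherwise it only changes the base point of the
        slice.\<close>
      have 2: "(\<lambda>w. f ((z(k := w))(i := (z(k := w)) i + h n))) field_differentiable at (z k)"
      proof (cases "k = i")
        case True
        have "(\<lambda>w. f (z(i := w))) field_differentiable at (z i + h n)"
          using holo_field_differentiable'[OF f _ i] in_shift[OF z] RV by blast
        moreover have "(\<lambda>w. w + h n) field_differentiable at (z i)"
          by (intro derivative_intros)
        ultimately have "((\<lambda>w. f (z(i := w))) \<circ> (\<lambda>w. w + h n)) field_differentiable at (z i)"
          by (intro field_differentiable_compose) auto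
        then show ?thesis using True by (simp add: o_def)
      next
        case False
        have "(\<lambda>w. f ((z(i := z i + h n))(k := w))) field_differentiable at ((z(i := z i + h n)) k)"
          using holo_field_differentiable[OF f _ k] in_shift[OF z] RV by blast
        then show ?thesis using False by (simp add: fun_upd_twist)
      qed
      show ?thesis unfolding q_def
        using h by (intro derivative_intros 1 2) auto
    qed
    show "uniform_limit (polydisc m z0 r) q (pd i f) sequentially"
      unfolding uniform_limit_iff
    proof (intro allI impI)
      fix e :: real assume e: "e > 0"
      have "(\<lambda>n. (8 * B / r ^ 2) * norm (h n)) \<longlonglongrightarrow> 0"
        by (intro tendsto_mult_right_zero tendsto_norm_zero hlim)
      then have "\<forall>\<^sub>F n in sequentially. (8 * B / r ^ 2) * norm (h n) < e"
        using e by (rule order_tendstoD(2))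
      then show "\<forall>\<^sub>F n in sequentially. \<forall>z\<in>polydisc m z0 r. dist (q n z) (pd i f z) < e"
      proof eventually_elim
        case (elim n)
        show ?case
        proof
          fix z assume z: "z \<in> polydisc m z0 r"
          define g where "g = (\<lambda>w. f (z(i := w)))"
          have "g holomorphic_on ball (z i) (2 * r)"
            unfolding holomorphic_on_def
          proof
            fix w assume "w \<in> ball (z i) (2 * r)"
            then have "z(i := w) \<in> V" using in_big[OF z] RV by auto
            then have "g field_differentiable at w"
              unfolding g_def by (rule holo_field_differentiable'[OF f _ i])
            then show "g field_differentiable at w within ball (z i) (2 * r)"
              by (rule field_differentiable_at_within)
          qed
          moreover have "norm (g w) < B" if "w \<in> ball (z i) (2 * r)" for w
            unfolding g_def using B in_big[OF z] that by auto
          ultimately have "norm ((g (z i + h n) - g (z i)) / h n - deriv g (z i))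
              \<le> (8 * B / r ^ 2) * norm (h n)"
            using r h by (intro Taylor_quotient_bound) auto
          then show "dist (q n z) (pd i f z) < e"
            using elim by (simp add: g_def q_def pd_def dist_norm)
        qed
      qed
    qed
  qed
qed

text \<open>
  \<^const>\<open>holo\<close> only asks for continuity and separate differentiability, so the differentiability of
  \<open>\<partial>f/\<partial>z\<^sub>i\<close> in the other variables needs an argument: difference quotients converge
  locally uniformly.
\<close>

lemma holo_pd:
  assumes V: "openin (top_of_set (Cn m)) V" and f: "holo m V f" and i: "i < m"
  shows "holo m V (pd i f)"
  unfolding holo_def
proof (intro conjI ballI allI impI)
  show "continuous_on V (pd i f)"
  proof (rule continuous_on_openin_locally)
    fix z0 assume z0: "z0 \<in> V"
    obtain r q where r: "r > 0" "polydisc m z0 r \<subseteq> V"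
      and q: "\<And>n. continuous_on (polydisc m z0 r) (q n)"
        "uniform_limit (polydisc m z0 r) q (pd i f) sequentially"
      using pd_uniform_limit[OF V f i z0] by metis
    have "continuous_on (polydisc m z0 r) (pd i f)"
      by (rule uniform_limit_theorem[OF _ q(2)]) (use q(1) in auto)
    moreover obtain U where "open U" "polydisc m z0 r = Cn m \<inter> U"
      using polydisc_open_ext by blast
    moreover have "V \<subseteq> Cn m" using openin_imp_subset[OF V] .
    ultimately show "\<exists>W. openin (top_of_set V) W \<and> z0 \<in> W \<and> continuous_on W (pd i f)"
      using r z0 by (intro exI[of _ "polydisc m z0 r"]) (auto simp: openin_open polydisc_def)
  qed
next
  fix z0 k assume z0: "z0 \<in> V" and k: "k < m"
  obtain r q where r: "r > 0" "polydisc m z0 r \<subseteq> V"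
    and q: "\<And>n z k. z \<in> polydisc m z0 r \<Longrightarrow> k < m \<Longrightarrow>
       (\<lambda>w. q n (z(k := w))) field_differentiable at (z k)"
      "uniform_limit (polydisc m z0 r) q (pd i f) sequentially"
    using pd_uniform_limit[OF V f i z0] by metis
  have z0': "z0 \<in> polydisc m z0 r"
    using r(1) z0 openin_imp_subset[OF V] by (auto simp: polydisc_def)
  have in_disc: "z0(k := w) \<in> polydisc m z0 r" if "w \<in> ball (z0 k) r" for w
    using polydisc_upd[OF z0' _ k] that by auto
  have "(\<lambda>w. pd i f (z0(k := w))) holomorphic_on ball (z0 k) r"
  proof (rule holomorphic_uniform_sequence[where f = "\<lambda>n w. q n (z0(k := w))"])
    show "(\<lambda>w. q n (z0(k := w))) holomorphic_on ball (z0 k) r" for n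
      unfolding holomorphic_on_def
    proof
      fix w assume "w \<in> ball (z0 k) r"
      from q(1)[OF in_disc[OF this] k, of n]
      show "(\<lambda>w. q n (z0(k := w))) field_differentiable at w within ball (z0 k) r"
        by (simp add: field_differentiable_at_within)
    qed
    show "\<exists>d. 0 < d \<and> cball x d \<subseteq> ball (z0 k) r \<and>
        uniform_limit (cball x d) (\<lambda>n w. q n (z0(k := w))) (\<lambda>w. pd i f (z0(k := w))) sequentially"
      if x: "x \<in> ball (z0 k) r" for x
    proof -
      obtain d where d: "d > 0" "cball x d \<subseteq> ball (z0 k) r"
        using x open_contains_cball[of "ball (z0 k) r"] by blast
      have "uniform_limit (cball x d) (\<lambda>n w. q n (z0(k := w))) (\<lambda>w. pd i f (z0(k := w))) sequentially"
        by (rule uniform_limit_compose'[OF q(2)]) (use in_disc d in auto)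
      then show ?thesis using d by blast
    qed
  qed auto
  then show "(\<lambda>w. pd i f (z0(k := w))) field_differentiable at (z0 k)"
    using r(1) by (intro holomorphic_on_imp_differentiable_at[of _ "ball (z0 k) r"]) auto
qed


section \<open>Rescaling the odd coordinates\<close>

text \<open>The algebra endomorphism induced by theta \<mapsto> c theta, read on
  coefficients.\<close>

definition gscale :: "complex \<Rightarrow> grassmann \<Rightarrow> grassmann" where
  "gscale c a = (\<lambda>J. c ^ card J * a J)"

lemma gscale_gmult: "gscale c (gmult a b) = gmult (gscale c a) (gscale c b)"
proof
  fix J
  show "gscale c (gmult a b) J = gmult (gscale c a) (gscale c b) J"
  proof (cases "finite J")
    case True
    have "c ^ card J = c ^ card K * c ^ card (J - K)" if "K \<in> Pow J" for K
    proof -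
      have "card J = card K + card (J - K)"
        using that True by (metis PowD card_Diff_subset card_mono finite_subset le_add_diff_inverse)
      then show ?thesis by (simp add: power_add)
    qed
    then show ?thesis
      unfolding gscale_def gmult_def sum_distrib_left by (intro sum.cong) auto
  next
    case False
    \<comment> \<open>The sum in \<open>gmult\<close> over an infinite power set is 0 by convention,
      so both sides vanish.\<close>
    then have "infinite (Pow J)" by simp
    then show ?thesis by (simp add: gscale_def gmult_def)
  qed
qed

lemma gscale_gone: "gscale c gone = gone"
  by (auto simp: gscale_def gone_def)

lemma gscale_gprod: "gscale c (gprod as) = gprod (map (gscale c) as)"
  by (induction as) (simp_all add: gprod_def gscale_gone gscale_gmult)

lemma gscale_gpow: "gscale c (gpow a k) = gpow (gscale c a) k"
  by (simp add: gpow_def gscale_gprod)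

lemma gmult_zero_left: "gmult (\<lambda>J. 0) b = (\<lambda>J. 0)"
  and gmult_zero_right: "gmult a (\<lambda>J. 0) = (\<lambda>J. 0)"
  by (simp_all add: gmult_def)

lemma gmult_cmult_left: "gmult (\<lambda>J. c * a J) b = (\<lambda>J. c * gmult a b J)"
  and gmult_cmult_right: "gmult a (\<lambda>J. c * b J) = (\<lambda>J. c * gmult a b J)"
  by (auto simp: gmult_def sum_distrib_left mult_ac intro!: sum.cong ext)

lemma gprod_zero: "(\<lambda>J. 0) \<in> set as \<Longrightarrow> gprod as = (\<lambda>J. 0)"
  by (induction as) (auto simp: gprod_def gmult_zero_left gmult_zero_right)

lemma gprod_cmult:
  "gprod (map (\<lambda>i J. c * f i J) xs) = (\<lambda>J. c ^ length xs * gprod (map f xs) J)"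
  by (induction xs) (simp_all add: gprod_def gmult_cmult_left gmult_cmult_right mult_ac)

lemma gpow_zero: "k > 0 \<Longrightarrow> gpow (\<lambda>J. 0) k = (\<lambda>J. 0)"
  unfolding gpow_def by (rule gprod_zero) auto

lemma gpow_0: "gpow a 0 = gone"
  by (simp add: gpow_def gprod_def)

lemma gmult_scalar:
  assumes "\<And>J. J \<noteq> {} \<Longrightarrow> a J = 0" "\<And>J. J \<noteq> {} \<Longrightarrow> b J = 0"
  shows "gmult a b = (\<lambda>J. if J = {} then a {} * b {} else 0)"
proof
  fix J :: "nat set"
  have "gsign K (J - K) * a K * b (J - K) = 0" if "J \<noteq> {}" "K \<in> Pow J" for K
  proof (cases "K = {}")
    case True
    then have "J - K \<noteq> {}" using that by auto
    then show ?thesis using assms(2) by simp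
  qed (simp add: assms(1))
  then have "gmult a b J = 0" if "J \<noteq> {}"
    unfolding gmult_def using that by (intro sum.neutral) auto
  then show "gmult a b J = (if J = {} then a {} * b {} else 0)"
    by (auto simp: gmult_def gsign_def)
qed

lemma gprod_gone: "(\<And>a. a \<in> set as \<Longrightarrow> a = gone) \<Longrightarrow> gprod as = gone"
proof (induction as)
  case (Cons a as)
  have "gmult gone gone = gone"
    by (subst gmult_scalar) (auto simp: gone_def)
  moreover have "a = gone" "gprod as = gone"
    using Cons by (auto intro: Cons.IH)
  ultimately show ?case by (simp add: gprod_def)
qed (simp add: gprod_def)

section \<open>Derivatives in x under a substitution in the parameter\<close>

lemma pd_rescale:
  assumes V': "openin (top_of_set (Cn M)) V'" and f: "holo M V f"
    and i: "i < M" "i \<noteq> k" and y: "y \<in> V'"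
    and \<sigma>: "\<And>y. y \<in> V' \<Longrightarrow> y(k := \<sigma> (y k)) \<in> V"
    and h: "\<And>y. y \<in> V' \<Longrightarrow> h y = c (y k) * f (y(k := \<sigma> (y k)))"
  shows "pd i h y = c (y k) * pd i f (y(k := \<sigma> (y k)))"
proof -
  define y' where "y' = y(k := \<sigma> (y k))"
  have "\<forall>\<^sub>F w in nhds (y i). y(i := w) \<in> V'"
    by (rule eventually_upd_in_openin[OF V' y i(1)])
  \<comment> \<open>As \<open>i \<noteq> k\<close>, slot \<open>k\<close> is constant along the
    slice, so the factor and the substituted value are constants for the derivative.\<close>
  then have "\<forall>\<^sub>F w in nhds (y i). h (y(i := w)) = c (y k) * f (y'(i := w))"
    by eventually_elim (use h i(2) in \<open>simp add: y'_def fun_upd_twist\<close>)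
  then have "pd i h y = deriv (\<lambda>w. c (y k) * f (y'(i := w))) (y i)"
    unfolding pd_def by (rule deriv_cong_ev) simp
  also have "\<dots> = c (y k) * deriv (\<lambda>w. f (y'(i := w))) (y' i)"
    using holo_field_differentiable[OF f \<sigma>[OF y] i(1)] i(2) unfolding y'_def
    by (subst deriv_cmult) auto
  finally show ?thesis by (simp add: pd_def y'_def)
qed

text \<open>Holomorphy of the iterates is part of the induction, because pulling the constant out of
  the next \<open>deriv\<close> requires differentiability. The intended instance has
  \<open>k\<close> the slot of \<open>t\<close>, \<open>\<sigma>\<close> inversion, and
  \<open>c\<close> a power of \<open>t^2\<close>.\<close>

lemma pd_funpow_rescale:
  assumes V: "openin (top_of_set (Cn M)) V" and V': "openin (top_of_set (Cn M)) V'"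
    and f: "holo M V f" and i: "i < M" "i \<noteq> k"
    and \<sigma>: "\<And>y. y \<in> V' \<Longrightarrow> y(k := \<sigma> (y k)) \<in> V"
    and h: "\<And>y. y \<in> V' \<Longrightarrow> h y = c (y k) * f (y(k := \<sigma> (y k)))"
  shows "holo M V ((pd i ^^ n) f) \<and>
    (\<forall>y\<in>V'. (pd i ^^ n) h y = c (y k) * (pd i ^^ n) f (y(k := \<sigma> (y k))))"
proof (induction n)
  case (Suc n)
  then have hol: "holo M V ((pd i ^^ n) f)"
    and eq: "\<And>y. y \<in> V' \<Longrightarrow> (pd i ^^ n) h y = c (y k) * (pd i ^^ n) f (y(k := \<sigma> (y k)))"
    by blast+
  show ?case
    using holo_pd[OF V hol i(1)] pd_rescale[OF V' hol i _ \<sigma> eq]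
    unfolding funpow.simps o_apply by blast
next
  case 0
  show ?case unfolding funpow.simps id_apply using f h by blast
qed

lemma foldr_pd_rescale:
  assumes V: "openin (top_of_set (Cn M)) V" and V': "openin (top_of_set (Cn M)) V'"
    and f: "holo M V f" and xs: "\<And>i. i \<in> set xs \<Longrightarrow> i < M \<and> i \<noteq> k"
    and \<sigma>: "\<And>y. y \<in> V' \<Longrightarrow> y(k := \<sigma> (y k)) \<in> V"
    and h: "\<And>y. y \<in> V' \<Longrightarrow> h y = c (y k) * f (y(k := \<sigma> (y k)))"
  shows "holo M V (foldr (\<lambda>i. pd i ^^ a i) xs f) \<and>
    (\<forall>y\<in>V'. foldr (\<lambda>i. pd i ^^ a i) xs h y = 
       c (y k) * foldr (\<lambda>i. pd i ^^ a i) xs f (y(k := \<sigma> (y k))))"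
  using xs
proof (induction xs)
  case (Cons x xs)
  then have hol: "holo M V (foldr (\<lambda>i. pd i ^^ a i) xs f)"
    and eq: "\<And>y. y \<in> V' \<Longrightarrow> foldr (\<lambda>i. pd i ^^ a i) xs h y =
       c (y k) * foldr (\<lambda>i. pd i ^^ a i) xs f (y(k := \<sigma> (y k)))"
    by (meson list.set_intros(2))+
  have "x < M" "x \<noteq> k" using Cons.prems by auto
  from pd_funpow_rescale[OF V V' hol this \<sigma> eq] show ?case
    unfolding foldr.simps o_apply by blast
next
  case Nil
  show ?case unfolding foldr.simps id_apply using f h by blast
qed

lemma mpd_Suc:
  "a m = 0 \<Longrightarrow> mpd (Suc m) a f = foldr (\<lambda>i. pd i ^^ a i) [0..<m] f"
  by (simp add: mpd_def)

text \<open>For functions coming from the base: they depend on \<open>t\<close> alone, so Taylor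
  terms of positive order in x drop out.\<close>

lemma pd_funpow_depends_on_one:
  assumes V: "openin (top_of_set (Cn M)) V" and i: "i < M" "i \<noteq> k"
    and f: "\<And>y. y \<in> V \<Longrightarrow> f y = G (y k)"
  shows "\<forall>y\<in>V. (pd i ^^ n) f y = (if n = 0 then G (y k) else 0)"
proof (induction n)
  case (Suc n)
  show ?case
  proof
    fix y assume y: "y \<in> V"
    have "\<forall>\<^sub>F w in nhds (y i). y(i := w) \<in> V"
      by (rule eventually_upd_in_openin[OF V y i(1)])
    then have "\<forall>\<^sub>F w in nhds (y i). (pd i ^^ n) f (y(i := w)) = (if n = 0 then G (y k) else 0)"
      by eventually_elim (use Suc i(2) in auto)
    then have "deriv (\<lambda>w. (pd i ^^ n) f (y(i := w))) (y i) =
        deriv (\<lambda>w. if n = 0 then G (y k) else 0) (y i)"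
      by (rule deriv_cong_ev) simp
    then show "(pd i ^^ Suc n) f y = (if Suc n = 0 then G (y k) else 0)"
      by (simp add: pd_def)
  qed
qed (use f in simp)

lemma foldr_pd_depends_on_one:
  assumes V: "openin (top_of_set (Cn M)) V" and xs: "\<And>i. i \<in> set xs \<Longrightarrow> i < M \<and> i \<noteq> k"
    and f: "\<And>y. y \<in> V \<Longrightarrow> f y = G (y k)"
  shows "\<forall>y\<in>V. foldr (\<lambda>i. pd i ^^ a i) xs f y = (if \<forall>i\<in>set xs. a i = 0 then G (y k) else 0)"
  using xs
proof (induction xs)
  case (Cons x xs)
  \<comment> \<open>The inner derivative is again a function of \<open>y k\<close> alone (zero or
    \<open>G\<close>), so the case distinction is absorbed into a new \<open>G\<close>.\<close>
  have "\<forall>y\<in>V. (pd x ^^ a x) (foldr (\<lambda>i. pd i ^^ a i) xs f) y =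
      (if a x = 0 then if \<forall>i\<in>set xs. a i = 0 then G (y k) else 0 else 0)"
    by (rule pd_funpow_depends_on_one[OF V,
          where G = "\<lambda>t. if \<forall>i\<in>set xs. a i = 0 then G t else 0"]) (use Cons in auto)
  then show ?case by (simp cong: conj_cong if_cong) (auto split: if_splits)
qed (use f in simp)

section \<open>Pullback along the transitions of the family\<close>

lemma body_rothstein_last: "body (Suc m) (rothstein_transition m F) z m = z m"
  by (simp add: body_def rothstein_transition_def)

lemma body_rothstein_upd:
  "body (Suc m) (rothstein_transition m F) (z(m := t)) =
     (body (Suc m) (rothstein_transition m F) z)(m := t)"
  by (auto simp: body_def rothstein_transition_def)

lemma soul_rothstein_last: "soul (rothstein_transition m F) z m = (\<lambda>J. 0)"
  by (auto simp: soul_def rothstein_transition_def)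

text \<open>The transitions fix \<open>t\<close> exactly, so its soul is zero and every Taylor
  monomial with a positive exponent at \<open>t\<close> vanishes.\<close>

lemma gprod_soul_rothstein_zero:
  assumes "a m > 0"
  shows "gprod (map (\<lambda>i. gpow (soul (rothstein_transition m F) z i) (a i)) [0..<Suc m]) = (\<lambda>J. 0)"
proof (rule gprod_zero)
  have "gpow (soul (rothstein_transition m F) z m) (a m) = (\<lambda>J. 0)"
    using assms by (simp add: soul_rothstein_last gpow_zero)
  then show "(\<lambda>J. 0) \<in>
      set (map (\<lambda>i. gpow (soul (rothstein_transition m F) z i) (a i)) [0..<Suc m])"
    by auto
qed

text \<open>In degree \<open>k\<close> this is t^(2k) (1/t)^k = t^k.\<close>

lemma soul_rothstein_inverse:
  assumes "z m \<noteq> 0"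
  shows "soul (rothstein_transition m F) z i =
    gscale ((z m)\<^sup>2) (soul (rothstein_transition m F) (z(m := inverse (z m))) i)"
proof
  fix J :: "nat set"
  have "(z m)\<^sup>2 ^ card J * inverse (z m) ^ card J = z m ^ card J"
    using assms by (simp add: power2_eq_square power_mult_distrib power_inverse)
  then show "soul (rothstein_transition m F) z i J =
      gscale ((z m)\<^sup>2) (soul (rothstein_transition m F) (z(m := inverse (z m))) i) J"
    by (simp add: soul_def gscale_def rothstein_transition_def mult.assoc[symmetric])
qed

text \<open>The exponent in odd components is \<open>k - 1\<close>, and t^(2k) (1/t)^(k-1) = t^2
  t^(k-1). The surplus \<open>t^2\<close> is the scaling of the odd coordinate itself and is divided
  out.\<close>

lemma odc_rothstein_inverse:
  assumes "z m \<noteq> 0" and F: "\<And>J. even (card J) \<Longrightarrow> odc F i (z(m := 0)) J = 0"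
  shows "odc (rothstein_transition m F) i z =
    (\<lambda>J. inverse ((z m)\<^sup>2) *
       gscale ((z m)\<^sup>2) (odc (rothstein_transition m F) i (z(m := inverse (z m)))) J)"
proof
  fix J :: "nat set"
  show "odc (rothstein_transition m F) i z J = inverse ((z m)\<^sup>2) *
       gscale ((z m)\<^sup>2) (odc (rothstein_transition m F) i (z(m := inverse (z m)))) J"
  proof (cases "even (card J)")
    case True
    \<comment> \<open>This also disposes of \<open>card J = 0\<close>, where the exponent
      \<open>card J - 1\<close> is truncated and the power count would fail.\<close>
    then show ?thesis using F by (simp add: gscale_def rothstein_transition_def)
  next
    case False
    then obtain d where d: "card J = Suc d" by (cases "card J") auto
    have "inverse ((z m)\<^sup>2) * (z m)\<^sup>2 ^ Suc d * inverse (z m) ^ d = z m ^ d"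
      using assms(1) by (simp add: power2_eq_square power_mult_distrib field_simps)
    then show ?thesis
      using d by (simp add: gscale_def rothstein_transition_def mult.assoc[symmetric])
  qed
qed

text \<open>The commutation of the involution with a transition, in terms of sections. In the
  summand of \<open>L\<close>, the coefficient of \<open>h\<close> contributes t^(2|L|), while the
  product of |L| odd components contributes t^(-2|L|). What is left is \<open>gscale\<close> of the
  product of souls and odd components, which is multiplicative and so acts on the whole
  summand.\<close>

lemma pullback_rothstein_inverse:
  fixes F m defines "T \<equiv> rothstein_transition m F"
  assumes t: "z m \<noteq> 0"
    and F: "\<And>i J. i < n \<Longrightarrow> even (card J) \<Longrightarrow> odc F i (z(m := 0)) J = 0"
    and V: "openin (top_of_set (Cn (Suc m))) V" and V': "openin (top_of_set (Cn (Suc m))) V'"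
    and g: "\<And>L. holo (Suc m) V (\<lambda>y. g y L)"
    and V'V: "\<And>y. y \<in> V' \<Longrightarrow> y(m := inverse (y m)) \<in> V"
    and h: "\<And>y. y \<in> V' \<Longrightarrow> h y = gscale ((y m)\<^sup>2) (g (y(m := inverse (y m))))"
    and z: "body (Suc m) T z \<in> V'"
  shows "pullback (Suc m) n T h z =
    gscale ((z m)\<^sup>2) (pullback (Suc m) n T g (z(m := inverse (z m))))"
proof
  fix J
  define z' where "z' = z(m := inverse (z m))"
  define S where "S z a = gprod (map (\<lambda>i. gpow (soul T z i) (a i)) [0..<Suc m])" for z and a :: "nat \<Rightarrow> nat"
  define O' where "O' z L = gprod (map (\<lambda>i. odc T i z) (sorted_list_of_set L))" for z L
  have body: "body (Suc m) T z' = (body (Suc m) T z)(m := inverse (z m))" "body (Suc m) T z m = z m"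
    by (simp_all add: T_def z'_def body_rothstein_upd body_rothstein_last)
  have eq: "mpd (Suc m) a (\<lambda>y. h y L) (body (Suc m) T z) / (\<Prod>i<Suc m. fact (a i)) *
        gmult (S z a) (O' z L) J =
      (z m)\<^sup>2 ^ card J * (mpd (Suc m) a (\<lambda>y. g y L) (body (Suc m) T z') / (\<Prod>i<Suc m. fact (a i)) *
        gmult (S z' a) (O' z' L) J)" (is "?l = ?r")
    if L: "L \<subseteq> {..<n}" for L a
  proof (cases "a m = 0")
    case False
    then have "S z a = (\<lambda>J. 0)" "S z' a = (\<lambda>J. 0)"
      by (simp_all add: S_def T_def gprod_soul_rothstein_zero del: upt_Suc)
    then show ?thesis by (simp add: gmult_zero_left)
  next
    case True
    \<comment> \<open>Since \<open>a m = 0\<close> only x-derivatives occur, and these commute with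
      the inversion of \<open>t\<close>.\<close>
    have "foldr (\<lambda>i. pd i ^^ a i) [0..<m] (\<lambda>y. h y L) (body (Suc m) T z) =
        ((body (Suc m) T z m)\<^sup>2) ^ card L * foldr (\<lambda>i. pd i ^^ a i) [0..<m] (\<lambda>y. g y L)
          ((body (Suc m) T z)(m := inverse (body (Suc m) T z m)))"
      using foldr_pd_rescale[OF V V' g, of "[0..<m]" m "inverse" "\<lambda>y. h y L"
          "\<lambda>t. (t\<^sup>2) ^ card L" L a] V'V h z
      by (auto simp: gscale_def)
    then have 1: "mpd (Suc m) a (\<lambda>y. h y L) (body (Suc m) T z) =
        (z m)\<^sup>2 ^ card L * mpd (Suc m) a (\<lambda>y. g y L) (body (Suc m) T z')"
      using True by (simp add: mpd_Suc body)
    have 2: "S z a = gscale ((z m)\<^sup>2) (S z' a)"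
      unfolding S_def gscale_gprod map_map o_def gscale_gpow z'_def T_def
      using soul_rothstein_inverse[of z m, OF t] by metis
    have fin: "finite L" using L finite_subset by blast
    have "map (\<lambda>i. odc T i z) (sorted_list_of_set L) =
        map (\<lambda>i J. inverse ((z m)\<^sup>2) * gscale ((z m)\<^sup>2) (odc T i z') J) (sorted_list_of_set L)"
      unfolding T_def z'_def
      by (intro map_cong refl odc_rothstein_inverse t F) (use L fin in auto)
    then have 3: "O' z L = (\<lambda>J. inverse ((z m)\<^sup>2) ^ card L * gscale ((z m)\<^sup>2) (O' z' L) J)"
      unfolding O'_def by (simp only: gprod_cmult gscale_gprod map_map o_def fin
          sorted_list_of_set.length_sorted_key_list_of_set)
    have 4: "gmult (S z a) (O' z L) J =
        inverse ((z m)\<^sup>2) ^ card L * ((z m)\<^sup>2 ^ card J * gmult (S z' a) (O' z' L) J)"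
      unfolding 2 3 gmult_cmult_right gscale_gmult[symmetric] by (simp add: gscale_def)
    \<comment> \<open>The powers t^(2|L|) from \<open>1\<close> and t^(-2|L|) from \<open>4\<close>
      cancel; t^(2|J|) remains.\<close>
    show ?thesis unfolding 1 4 using t by (simp add: power_inverse)
  qed
  show "pullback (Suc m) n T h z J = gscale ((z m)\<^sup>2) (pullback (Suc m) n T g z') J"
    unfolding pullback_def gscale_def sum_distrib_left
    by (intro sum.cong refl eq[unfolded S_def O'_def]) auto
qed

text \<open>Only the summand with \<open>L = {}\<close> and \<open>a = 0\<close> survives, and it
  evaluates \<open>G\<close> at the unchanged parameter. Hence \<open>t\<close> and functions of it
  are globally defined on the family.\<close>

lemma pullback_rothstein_scalar:
  fixes F m defines "T \<equiv> rothstein_transition m F"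
  assumes V: "openin (top_of_set (Cn (Suc m))) V" and z: "body (Suc m) T z \<in> V"
    and g: "\<And>y. y \<in> V \<Longrightarrow> g y = (\<lambda>J. if J = {} then G (y m) else 0)"
  shows "pullback (Suc m) n T g z = (\<lambda>J. if J = {} then G (z m) else 0)"
proof
  fix J
  define b where "b = body (Suc m) T z"
  define S where "S a = gprod (map (\<lambda>i. gpow (soul T z i) (a i)) [0..<Suc m])" for a :: "nat \<Rightarrow> nat"
  define O' where "O' L = gprod (map (\<lambda>i. odc T i z) (sorted_list_of_set L))" for L
  have b: "b m = z m" "b \<in> V" using z by (simp_all add: b_def T_def body_rothstein_last)
  have summand: "mpd (Suc m) a (\<lambda>y. g y L) b / (\<Prod>i<Suc m. fact (a i)) * gmult (S a) (O' L) J =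
      (if L = {} \<and> a = (\<lambda>i. 0) then (if J = {} then G (z m) else 0) else 0)"
    if a: "a \<in> multi_indices (Suc m) n" for L a
  proof (cases "a m = 0")
    case False
    then have "S a = (\<lambda>J. 0)"
      by (simp add: S_def T_def gprod_soul_rothstein_zero del: upt_Suc)
    then show ?thesis using False by (auto simp: gmult_zero_left)
  next
    case True
    \<comment> \<open>Entries beyond \<open>m\<close> vanish by \<open>multi_indices\<close>, and
      entry \<open>m\<close> by the present case.\<close>
    have a0: "(\<forall>i\<in>set [0..<m]. a i = 0) \<longleftrightarrow> a = (\<lambda>i. 0)"
      using a True unfolding multi_indices_def fun_eq_iff
      by (auto simp: Suc_le_eq) (metis atLeastLessThan_iff le0 linorder_neqE_nat)
    have "\<forall>y\<in>V. foldr (\<lambda>i. pd i ^^ a i) [0..<m] (\<lambda>y. g y L) y =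
        (if \<forall>i\<in>set [0..<m]. a i = 0 then if L = {} then G (y m) else 0 else 0)"
      by (rule foldr_pd_depends_on_one[OF V,
            where G = "\<lambda>t. if L = {} then G t else 0"]) (use g in auto)
    then have 1: "mpd (Suc m) a (\<lambda>y. g y L) b =
        (if a = (\<lambda>i. 0) then if L = {} then G (z m) else 0 else 0)"
      using b True unfolding a0 by (simp add: mpd_Suc)
    have "gmult (S a) (O' L) J = (if J = {} then 1 else 0)" if "a = (\<lambda>i. 0)" "L = {}"
    proof -
      have "S a = gone" unfolding S_def using that
        by (intro gprod_gone) (auto simp: gpow_0)
      moreover have "O' L = gone" using that by (simp add: O'_def gprod_def)
      ultimately show ?thesis by (simp add: gmult_scalar gone_def)
    qed
    then show ?thesis unfolding 1 by auto
  qed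
  \<comment> \<open>Finiteness lets \<open>sum.delta\<close> pick out the surviving term. Each entry
    is bounded by the total degree.\<close>
  have fin: "finite (multi_indices (Suc m) n)"
  proof (rule finite_subset)
    show "multi_indices (Suc m) n \<subseteq> {a. \<forall>i. (i \<in> {..<Suc m} \<longrightarrow> a i \<in> {..n}) \<and> (i \<notin> {..<Suc m} \<longrightarrow> a i = 0)}"
    proof clarify
      fix a i assume a: "a \<in> multi_indices (Suc m) n"
      have "a i \<le> (\<Sum>i<Suc m. a i)" if "i < Suc m"
        by (rule member_le_sum) (use that in auto)
      then show "(i \<in> {..<Suc m} \<longrightarrow> a i \<in> {..n}) \<and> (i \<notin> {..<Suc m} \<longrightarrow> a i = 0)"
        using a by (auto simp: multi_indices_def)
    qed
  qed (intro finite_set_of_finite_funs; simp)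
  have "pullback (Suc m) n T g z J = (\<Sum>L\<in>Pow {..<n}. \<Sum>a\<in>multi_indices (Suc m) n.
      (if L = {} \<and> a = (\<lambda>i. 0) then (if J = {} then G (z m) else 0) else 0))"
    unfolding pullback_def
    by (intro sum.cong refl summand[unfolded S_def O'_def b_def]) auto
  also have "\<dots> = (\<Sum>L\<in>Pow {..<n}. if L = {} then \<Sum>a\<in>multi_indices (Suc m) n.
      (if a = (\<lambda>i. 0) then (if J = {} then G (z m) else 0) else 0) else 0)"
    by (intro sum.cong) auto
  also have "\<dots> = (\<Sum>a\<in>multi_indices (Suc m) n.
      (if a = (\<lambda>i. 0) then (if J = {} then G (z m) else 0) else 0))"
    by (simp add: sum.delta)
  also have "\<dots> = (if J = {} then G (z m) else 0)"
    using fin by (simp add: sum.delta multi_indices_def)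
  finally show "pullback (Suc m) n T g z J = (if J = {} then G (z m) else 0)" .
qed


section \<open>Sections over the punctured line\<close>

text \<open>Differentiability in \<open>holo\<close> refers to full neighbourhoods of
  \<open>z i\<close>; agreement on \<open>V\<close> suffices because \<open>V\<close> is relatively
  open.\<close>

lemma holo_transform:
  assumes V: "openin (top_of_set (Cn m)) V" and f: "holo m V f" and g: "\<And>z. z \<in> V \<Longrightarrow> g z = f z"
  shows "holo m V g"
  unfolding holo_def
proof (intro conjI ballI allI impI)
  show "continuous_on V g"
    using continuous_on_holo[OF f] g by (simp cong: continuous_on_cong)
  fix z i assume z: "z \<in> V" and i: "i < m"
  obtain D where "((\<lambda>w. f (z(i := w))) has_field_derivative D) (at (z i))"
    using holo_field_differentiable[OF f z i] by (auto simp: field_differentiable_def)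
  moreover have "\<forall>\<^sub>F w in nhds (z i). f (z(i := w)) = g (z(i := w))"
    using eventually_upd_in_openin[OF V z i] by eventually_elim (simp add: g)
  ultimately have "((\<lambda>w. g (z(i := w))) has_field_derivative D) (at (z i))"
    by (subst DERIV_cong_ev[OF refl _ refl, symmetric])
  then show "(\<lambda>w. g (z(i := w))) field_differentiable at (z i)"
    by (auto simp: field_differentiable_def)
qed

text \<open>With \<open>k = card J\<close> this function is the \<open>J\<close>-coefficient of a
  section after the substitution (x, 1/t|t^2 theta).\<close>

lemma holo_invert:
  assumes f: "holo (Suc m) V f" and z: "\<And>z. z \<in> V' \<Longrightarrow> z m \<noteq> 0 \<and> z(m := inverse (z m)) \<in> V"
  shows "holo (Suc m) V' (\<lambda>z. (z m)\<^sup>2 ^ k * f (z(m := inverse (z m))))"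
  unfolding holo_def
proof (intro conjI ballI allI impI)
  have "continuous_on V' (\<lambda>z. f (z(m := inverse (z m))))"
    by (rule continuous_on_compose2[OF continuous_on_holo[OF f]])
       (use z in \<open>auto intro!: continuous_on_fun_upd continuous_on_id continuous_on_inverse continuous_on_nth\<close>)
  then show "continuous_on V' (\<lambda>z. (z m)\<^sup>2 ^ k * f (z(m := inverse (z m))))"
    by (intro continuous_intros continuous_on_nth)
  fix y i assume y: "y \<in> V'" and i: "i < Suc m"
  show "(\<lambda>w. ((y(i := w)) m)\<^sup>2 ^ k * f ((y(i := w))(m := inverse ((y(i := w)) m))))
      field_differentiable at (y i)"
  proof (cases "i = m")
    case True
    \<comment> \<open>Here, unlike in the Taylor sums, \<open>inverse\<close> is differentiated; the
      hypothesis keeps the parameter away from 0.\<close>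
    have "(\<lambda>w. f (y(m := w))) field_differentiable at (inverse (y m))"
      using holo_field_differentiable'[OF f] z[OF y] by auto
    moreover have "inverse field_differentiable at (y m)"
      using z[OF y] by (auto intro!: derivative_intros)
    ultimately have "((\<lambda>w. f (y(m := w))) \<circ> inverse) field_differentiable at (y m)"
      by (intro field_differentiable_compose) auto
    then show ?thesis using True
      by (auto simp: o_def intro!: derivative_intros)
  next
    case False
    have "(\<lambda>w. f ((y(m := inverse (y m)))(i := w))) field_differentiable at ((y(m := inverse (y m))) i)"
      using holo_field_differentiable[OF f] z[OF y] i by blast
    then show ?thesis using False
      by (auto simp: fun_upd_twist intro!: derivative_intros)
  qed
qed

lemma holo_last_coordinate:
  assumes G: "\<And>t. t \<in> U \<Longrightarrow> G field_differentiable at t" and V: "\<And>z. z \<in> V \<Longrightarrow> z m \<in> U"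
  shows "holo (Suc m) V (\<lambda>z. G (z m))"
  unfolding holo_def
proof (intro conjI ballI allI impI)
  have "continuous_on U G"
    using G by (meson continuous_at_imp_continuous_on field_differentiable_imp_continuous_at)
  then show "continuous_on V (\<lambda>z. G (z m))"
    by (rule continuous_on_compose2) (use V continuous_on_nth in auto)
  fix z i assume "z \<in> V"
  then show "(\<lambda>w. G ((z(i := w)) m)) field_differentiable at (z i)"
    using G V by (cases "i = m") auto
qed

section \<open>Coordinates on the product of X with the parameter line\<close>

lemma coordsI:
  "(p, t) \<in> W \<Longrightarrow> p \<in> patch M \<alpha> \<Longrightarrow> (chart M \<alpha> p)(mdim M := t) \<in> coords M \<alpha> W"
  by (auto simp: coords_def)

lemma coordsE:
  assumes "z \<in> coords M \<alpha> W"
  obtains p t where "(p, t) \<in> W" "p \<in> patch M \<alpha>" "z = (chart M \<alpha> p)(mdim M := t)"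
  using assms by (auto simp: coords_def)

lemma coords_mono: "W \<subseteq> W' \<Longrightarrow> coords M \<alpha> W \<subseteq> coords M \<alpha> W'"
  by (auto simp: coords_def)

text \<open>The image is rewritten as a preimage: with \<open>\<psi>\<close> the inverse chart,
  \<open>z\<close> belongs to it iff \<open>(\<psi> (z(m := 0)), z m)\<close> lies in
  \<open>W\<close>. Setting slot \<open>m\<close> to 0 is the projection from
  \<open>Cn (Suc m)\<close> to \<open>Cn m\<close>, so continuity of \<open>\<psi>\<close> gives
  openness.\<close>

lemma openin_coords:
  assumes M: "complex_manifold M" and \<alpha>: "\<alpha> \<in> mindex M"
    and W: "openin (prod_topology (mspace M) euclidean) W"
  shows "openin (top_of_set (Cn (Suc (mdim M)))) (coords M \<alpha> W)"
proof -
  define m where "m = mdim M"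
  define C where "C = chart M \<alpha> ` patch M \<alpha>"
  have C: "openin (top_of_set (Cn m)) C"
    and hom: "homeomorphic_map (subtopology (mspace M) (patch M \<alpha>)) (top_of_set C) (chart M \<alpha>)"
    and P: "openin (mspace M) (patch M \<alpha>)"
    using M \<alpha> by (auto simp: complex_manifold_def m_def C_def)
  obtain \<psi> where \<psi>: "homeomorphic_maps (subtopology (mspace M) (patch M \<alpha>)) (top_of_set C) (chart M \<alpha>) \<psi>"
    using hom by (auto simp: homeomorphic_map_maps)
  have Psub: "patch M \<alpha> \<subseteq> topspace (mspace M)" using openin_subset[OF P] .
  have \<psi>_chart: "\<psi> (chart M \<alpha> p) = p" if "p \<in> patch M \<alpha>" for p
    using \<psi> that Psub by (auto simp: homeomorphic_maps_def)
  have \<psi>_cont: "continuous_map (top_of_set C) (mspace M) \<psi>"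
    and \<psi>_in: "\<And>c. c \<in> C \<Longrightarrow> \<psi> c \<in> patch M \<alpha> \<and> chart M \<alpha> (\<psi> c) = c"
    using \<psi> Psub by (auto simp: homeomorphic_maps_def continuous_map_in_subtopology)
  define D where "D = {z \<in> Cn (Suc m). z(m := 0) \<in> C}"
  have cont0: "continuous_on A (\<lambda>z :: cvec. z(m := 0))" for A
    by (intro continuous_intros continuous_on_id)
  have D: "openin (top_of_set (Cn (Suc m))) D"
    unfolding D_def
    using openin_continuous_map_preimage[OF _ C, of "top_of_set (Cn (Suc m))" "\<lambda>z. z(m := 0)"] cont0
    by (auto simp: Cn_def)
  have "continuous_map (top_of_set D) (prod_topology (mspace M) euclidean) (\<lambda>z. (\<psi> (z(m := 0)), z m))"
  proof (intro continuous_map_pairedI)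
    have "continuous_map (top_of_set D) (top_of_set C) (\<lambda>z. z(m := 0))"
      using cont0 by (auto simp: D_def)
    from continuous_map_compose[OF this \<psi>_cont]
    show "continuous_map (top_of_set D) (mspace M) (\<lambda>z. \<psi> (z(m := 0)))"
      by (simp add: o_def)
    show "continuous_map (top_of_set D) euclidean (\<lambda>z. z m)"
      using continuous_on_nth by auto
  qed
  from openin_continuous_map_preimage[OF this W]
  have "openin (top_of_set (Cn (Suc m))) {z \<in> D. (\<psi> (z(m := 0)), z m) \<in> W}"
    using openin_trans[OF _ D] by simp
  moreover have "coords M \<alpha> W = {z \<in> D. (\<psi> (z(m := 0)), z m) \<in> W}"
  proof (intro subset_antisym subsetI)
    fix z assume "z \<in> coords M \<alpha> W"
    then obtain p t where z: "(p, t) \<in> W" "p \<in> patch M \<alpha>" "z = (chart M \<alpha> p)(m := t)"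
      by (auto simp: coords_def m_def)
    have "chart M \<alpha> p \<in> Cn m" "chart M \<alpha> p \<in> C"
      using z(2) openin_imp_subset[OF C] by (auto simp: C_def)
    moreover then have "z(m := 0) = chart M \<alpha> p"
      using z(3) by (auto simp: Cn_def)
    ultimately show "z \<in> {z \<in> D. (\<psi> (z(m := 0)), z m) \<in> W}"
      using z by (auto simp: D_def \<psi>_chart Cn_def)
  next
    fix z assume z: "z \<in> {z \<in> D. (\<psi> (z(m := 0)), z m) \<in> W}"
    then have "(chart M \<alpha> (\<psi> (z(m := 0))))(m := z m) \<in> coords M \<alpha> W"
      using \<psi>_in[of "z(m := 0)"] unfolding m_def by (intro coordsI) (auto simp: D_def m_def)
    then show "z \<in> coords M \<alpha> W"
      using z \<psi>_in[of "z(m := 0)"] by (auto simp: D_def)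
  qed
  ultimately show ?thesis by (simp add: m_def)
qed

lemma chart_Cn:
  assumes "complex_manifold M" "\<alpha> \<in> mindex M" "p \<in> patch M \<alpha>"
  shows "chart M \<alpha> p \<in> Cn (mdim M)"
  using assms openin_imp_subset by (fastforce simp: complex_manifold_def)

lemma chart_upd_last:
  assumes "complex_manifold M" "\<alpha> \<in> mindex M" "p \<in> patch M \<alpha>"
  shows "(chart M \<alpha> p)(mdim M := 0) = chart M \<alpha> p"
  using chart_Cn[OF assms] by (auto simp: Cn_def)

lemma transition_chart:
  assumes M: "complex_manifold M" "\<alpha> \<in> mindex M" and p: "p \<in> patch M \<alpha>"
  shows "transition M \<alpha> \<beta> (chart M \<alpha> p) = chart M \<beta> p"
proof -
  have "homeomorphic_map (subtopology (mspace M) (patch M \<alpha>))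
          (top_of_set (chart M \<alpha> ` patch M \<alpha>)) (chart M \<alpha>)"
    and "patch M \<alpha> \<subseteq> topspace (mspace M)"
    using M by (auto simp: complex_manifold_def dest: openin_subset)
  then have "inj_on (chart M \<alpha>) (patch M \<alpha>)"
    by (auto dest!: homeomorphic_imp_injective_map simp: Int_absorb1)
  then show ?thesis using p by (simp add: transition_def)
qed

lemma supermanifold_complex_manifold: "is_supermanifold j S \<Longrightarrow> complex_manifold S"
  by (simp add: is_supermanifold_def is_model_def)

text \<open>On reduced points the transition is the change of charts of X with \<open>t\<close>
  kept, so \<open>z\<close> and its body are coordinates of one and the same point.\<close>

lemma body_rothstein_in_coords:
  assumes S: "is_supermanifold j S" and \<alpha>: "\<alpha> \<in> mindex S" and \<beta>: "\<beta> \<in> mindex S"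
    and z: "z \<in> coords S \<alpha> (W \<inter> patch S \<beta> \<times> UNIV)"
  shows "body (Suc (mdim S)) (rothstein_transition (mdim S) (rho S \<alpha> \<beta>)) z \<in> coords S \<beta> W"
proof -
  note M = supermanifold_complex_manifold[OF S]
  obtain p t where p: "(p, t) \<in> W" "p \<in> patch S \<beta>" "p \<in> patch S \<alpha>" "z = (chart S \<alpha> p)(mdim S := t)"
    using z by (auto elim: coordsE)
  have ov: "chart S \<alpha> p \<in> overlap S \<alpha> \<beta>" using p by (auto simp: overlap_def)
  have z0: "z(mdim S := 0) = chart S \<alpha> p"
    using p chart_upd_last[OF M \<alpha> p(3)] by simp
  have "body (Suc (mdim S)) (rothstein_transition (mdim S) (rho S \<alpha> \<beta>)) z = (chart S \<beta> p)(mdim S := t)"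
  proof
    fix i
    have "evc (rho S \<alpha> \<beta>) i (chart S \<alpha> p) {} = chart S \<beta> p i" if "i < mdim S"
      using S \<alpha> \<beta> ov that transition_chart[OF M \<alpha> p(3), of \<beta>]
      by (auto simp: is_supermanifold_def transition_of_type_def)
    moreover have "chart S \<beta> p i = 0" if "i \<ge> mdim S"
      using chart_Cn[OF M \<beta> p(2)] that by (auto simp: Cn_def)
    ultimately show "body (Suc (mdim S)) (rothstein_transition (mdim S) (rho S \<alpha> \<beta>)) z i =
        ((chart S \<beta> p)(mdim S := t)) i"
      using p(4) z0 by (auto simp: body_def rothstein_transition_def)
  qed
  then show ?thesis using p by (auto intro: coordsI)
qed

lemma odc_rho_even:
  assumes S: "is_supermanifold j S" and \<alpha>: "\<alpha> \<in> mindex S" and \<beta>: "\<beta> \<in> mindex S"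
    and z: "z \<in> coords S \<alpha> (W \<inter> patch S \<beta> \<times> UNIV)" and i: "i < mrank S" and J: "even (card J)"
  shows "odc (rho S \<alpha> \<beta>) i (z(mdim S := 0)) J = 0"
proof -
  note M = supermanifold_complex_manifold[OF S]
  obtain p t where p: "(p, t) \<in> W" "p \<in> patch S \<beta>" "p \<in> patch S \<alpha>" "z = (chart S \<alpha> p)(mdim S := t)"
    using z by (auto elim: coordsE)
  have "z(mdim S := 0) \<in> overlap S \<alpha> \<beta>"
    using p chart_upd_last[OF M \<alpha> p(3)] by (auto simp: overlap_def)
  then show ?thesis
    using S \<alpha> \<beta> i J by (auto simp: is_supermanifold_def transition_of_type_def)
qed

section \<open>The involution on open sets and on sections\<close>

definition invert :: "('p \<times> complex) set \<Rightarrow> ('p \<times> complex) set" where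
  "invert V = {(p, t). t \<noteq> 0 \<and> (p, inverse t) \<in> V}"

text \<open>As \<open>inverse 0 = 0\<close>, it is the clause \<open>t \<noteq> 0\<close> in
  \<open>invert\<close> that excludes the fibre over 0; the original set is recovered when it avoids
  that fibre.\<close>

lemma invert_invert: "V \<subseteq> UNIV \<times> - {0} \<Longrightarrow> invert (invert V) = V"
  by (auto simp: invert_def)

lemma coords_invert:
  "z \<in> coords M \<alpha> (invert V) \<longleftrightarrow>
     z (mdim M) \<noteq> 0 \<and> z(mdim M := inverse (z (mdim M))) \<in> coords M \<alpha> V" (is "?l \<longleftrightarrow> ?r")
proof
  assume ?l then show ?r
    by (auto simp: invert_def elim!: coordsE intro!: coordsI)
next
  assume r: ?r
  then obtain p t where p: "(p, t) \<in> V" "p \<in> patch M \<alpha>"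
      "z(mdim M := inverse (z (mdim M))) = (chart M \<alpha> p)(mdim M := t)"
    by (auto elim!: coordsE)
  have t: "t = inverse (z (mdim M))" using fun_cong[OF p(3), of "mdim M"] by simp
  have "z = (z(mdim M := inverse (z (mdim M))))(mdim M := z (mdim M))" by simp
  also have "\<dots> = (chart M \<alpha> p)(mdim M := z (mdim M))" by (simp only: p(3) fun_upd_upd)
  finally show ?l
    using coordsI[of p "z (mdim M)" "invert V" M \<alpha>] p r t by (auto simp: invert_def)
qed

text \<open>Inversion is continuous only away from 0, so openness is first obtained in the open part
  over \<open>t \<noteq> 0\<close>.\<close>

lemma openin_invert:
  assumes V: "openin (prod_topology X euclidean) V"
  shows "openin (prod_topology X euclidean) (invert V)"
proof -
  let ?A = "topspace X \<times> - {0 :: complex}"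
  have A: "openin (prod_topology X euclidean) ?A"
    by (simp add: openin_prod_Times_iff open_Compl)
  have snd: "continuous_map (subtopology (prod_topology X euclidean) ?A) (top_of_set (- {0})) snd"
    by (auto simp: continuous_map_in_subtopology intro: continuous_map_from_subtopology continuous_map_snd)
  have inv: "continuous_map (top_of_set (- {0 :: complex})) euclidean inverse"
    by (auto intro!: continuous_intros)
  have "continuous_map (subtopology (prod_topology X euclidean) ?A) (prod_topology X euclidean)
      (\<lambda>x. (fst x, inverse (snd x)))"
    using continuous_map_compose[OF snd inv]
    by (intro continuous_map_pairedI)
       (auto simp: o_def intro: continuous_map_from_subtopology continuous_map_fst)
  from openin_continuous_map_preimage[OF this V] have
    "openin (subtopology (prod_topology X euclidean) ?A)
       {x \<in> topspace (subtopology (prod_topology X euclidean) ?A). (fst x, inverse (snd x)) \<in> V}" .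
  moreover have "{x \<in> topspace (subtopology (prod_topology X euclidean) ?A).
      (fst x, inverse (snd x)) \<in> V} = invert V"
    using openin_subset[OF V] by (auto simp: invert_def)
  ultimately show ?thesis using openin_trans_full[OF _ A] by simp
qed

text \<open>The section s(x, 1/t|t^2 theta). It is extended by 0 because sections are normalised
  that way, which makes equality of sections plain equality of functions.\<close>

definition invert_pull ::
  "('p, 'i, 'z) supermanifold_scheme \<Rightarrow> ('p \<times> complex) set \<Rightarrow> 'i sections \<Rightarrow> 'i sections" where
  "invert_pull S V s = (\<lambda>\<alpha> z J. if z \<in> coords S \<alpha> (invert V)
     then gscale ((z (mdim S))\<^sup>2) (s \<alpha> (z(mdim S := inverse (z (mdim S))))) J else 0)"

text \<open>Holomorphy holds coefficient by coefficient. The matching condition on overlaps survives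
  because the substitution commutes with the transitions.\<close>

lemma invert_pull_in_sections:
  assumes S: "is_supermanifold j S" and V: "openin (prod_topology (mspace S) euclidean) V"
    and s: "s \<in> rothstein_sections S V"
  shows "invert_pull S V s \<in> rothstein_sections S (invert V)"
  unfolding rothstein_sections_def mem_Collect_eq
proof (intro conjI ballI allI impI)
  note M = supermanifold_complex_manifold[OF S]
  let ?m = "mdim S"
  fix \<alpha> assume \<alpha>: "\<alpha> \<in> mindex S"
  have hol: "\<And>J \<gamma>. \<gamma> \<in> mindex S \<Longrightarrow> holo (Suc ?m) (coords S \<gamma> V) (\<lambda>z. s \<gamma> z J)"
    and zero: "\<And>z J. z \<in> coords S \<alpha> V \<Longrightarrow> \<not> J \<subseteq> {..<mrank S} \<Longrightarrow> s \<alpha> z J = 0"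
    and glue: "\<And>\<beta> z. \<beta> \<in> mindex S \<Longrightarrow> z \<in> coords S \<alpha> (V \<inter> patch S \<beta> \<times> UNIV) \<Longrightarrow>
      s \<alpha> z = pullback (Suc ?m) (mrank S) (rothstein_transition ?m (rho S \<alpha> \<beta>)) (s \<beta>) z"
    using s \<alpha> by (auto simp: rothstein_sections_def superholo_def)
  note op = openin_coords[OF M _ V] openin_coords[OF M _ openin_invert[OF V]]
  show "superholo (Suc ?m) (mrank S) (coords S \<alpha> (invert V)) (invert_pull S V s \<alpha>)"
    unfolding superholo_def
  proof (intro conjI allI ballI impI)
    fix J
    show "holo (Suc ?m) (coords S \<alpha> (invert V)) (\<lambda>z. invert_pull S V s \<alpha> z J)"
      by (rule holo_transform[OF op(2)[OF \<alpha>]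
            holo_invert[OF hol[OF \<alpha>, of J], of "coords S \<alpha> (invert V)" "card J"]])
         (auto simp: coords_invert invert_pull_def gscale_def)
  next
    fix z J assume "z \<in> coords S \<alpha> (invert V)" "\<not> J \<subseteq> {..<mrank S}"
    then show "invert_pull S V s \<alpha> z J = 0"
      using zero by (auto simp: coords_invert invert_pull_def gscale_def)
  qed
  fix \<beta> z assume \<beta>: "\<beta> \<in> mindex S" and z: "z \<in> coords S \<alpha> (invert V \<inter> patch S \<beta> \<times> UNIV)"
  \<comment> \<open>Restricting to a patch does not involve the parameter, so it commutes with
    \<open>invert\<close>.\<close>
  have "invert V \<inter> patch S \<beta> \<times> UNIV = invert (V \<inter> patch S \<beta> \<times> UNIV)"
    by (auto simp: invert_def)
  then have z': "z ?m \<noteq> 0" "z(?m := inverse (z ?m)) \<in> coords S \<alpha> (V \<inter> patch S \<beta> \<times> UNIV)"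
    using z by (simp_all add: coords_invert)
  have "z \<in> coords S \<alpha> (invert V)" using z coords_mono[of _ "invert V" S \<alpha>] by blast
  then have "invert_pull S V s \<alpha> z = gscale ((z ?m)\<^sup>2) (s \<alpha> (z(?m := inverse (z ?m))))"
    by (simp add: invert_pull_def)
  also have "\<dots> = gscale ((z ?m)\<^sup>2) (pullback (Suc ?m) (mrank S)
      (rothstein_transition ?m (rho S \<alpha> \<beta>)) (s \<beta>) (z(?m := inverse (z ?m))))"
    using glue[OF \<beta> z'(2)] by simp
  also have "\<dots> = pullback (Suc ?m) (mrank S)
      (rothstein_transition ?m (rho S \<alpha> \<beta>)) (invert_pull S V s \<beta>) z"
  proof (rule pullback_rothstein_inverse[OF _ _ op(1)[OF \<beta>] op(2)[OF \<beta>] hol[OF \<beta>], symmetric])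
    show "z ?m \<noteq> 0" by fact
    show "odc (rho S \<alpha> \<beta>) i (z(?m := 0)) J = 0" if "i < mrank S" "even (card J)" for i J
      using odc_rho_even[OF S \<alpha> \<beta> z that] .
    show "body (Suc ?m) (rothstein_transition ?m (rho S \<alpha> \<beta>)) z \<in> coords S \<beta> (invert V)"
      using body_rothstein_in_coords[OF S \<alpha> \<beta> z] .
  qed (auto simp: coords_invert invert_pull_def)
  finally show "invert_pull S V s \<alpha> z = pullback (Suc ?m) (mrank S)
      (rothstein_transition ?m (rho S \<alpha> \<beta>)) (invert_pull S V s \<beta>) z" .
next
  fix \<alpha> z J assume "\<alpha> \<notin> mindex S \<or> z \<notin> coords S \<alpha> (invert V)"
  then show "invert_pull S V s \<alpha> z J = 0"
    using s by (auto simp: invert_pull_def gscale_def rothstein_sections_def)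
qed

text \<open>The second application multiplies by powers of (1/t)^2, taken at the inverted parameter,
  which undo those of \<open>t^2\<close>. Outside the coordinate image both sides are 0 by
  normalisation.\<close>

lemma invert_pull_invert_pull:
  assumes V: "V \<subseteq> UNIV \<times> - {0}" and s: "s \<in> rothstein_sections S V"
  shows "invert_pull S (invert V) (invert_pull S V s) = s"
proof (intro ext)
  fix \<alpha> z J
  show "invert_pull S (invert V) (invert_pull S V s) \<alpha> z J = s \<alpha> z J"
  proof (cases "z \<in> coords S \<alpha> V")
    case True
    then have t: "z (mdim S) \<noteq> 0" using V by (auto elim!: coordsE)
    have "(z (mdim S))\<^sup>2 ^ card J * (inverse (z (mdim S)))\<^sup>2 ^ card J = 1"
      using t by (simp add: power_mult_distrib[symmetric])
    then show ?thesis using True t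
      by (simp add: invert_pull_def invert_invert[OF V] coords_invert gscale_def mult.assoc[symmetric])
  next
    case False
    then show ?thesis using s
      by (simp add: invert_pull_def invert_invert[OF V] rothstein_sections_def)
  qed
qed

lemma rothstein_scalar_in_sections:
  assumes S: "is_supermanifold j S" and U: "open U" and G: "G holomorphic_on U"
  shows "rothstein_scalar S (topspace (mspace S) \<times> U) G \<in>
    rothstein_sections S (topspace (mspace S) \<times> U)" (is "?s \<in> rothstein_sections S ?W")
proof -
  note M = supermanifold_complex_manifold[OF S]
  have W: "openin (prod_topology (mspace S) euclidean) ?W"
    using U by (simp add: openin_prod_Times_iff)
  have last: "z (mdim S) \<in> U" if "z \<in> coords S \<alpha> ?W" for \<alpha> z
    using that by (auto elim!: coordsE)
  have "holo (Suc (mdim S)) (coords S \<alpha> ?W) (\<lambda>z. ?s \<alpha> z J)" if \<alpha>: "\<alpha> \<in> mindex S" for \<alpha> J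
  proof (cases "J = {}")
    case True
    have "G field_differentiable at t" if "t \<in> U" for t
      using G U that by (rule holomorphic_on_imp_differentiable_at)
    then have "holo (Suc (mdim S)) (coords S \<alpha> ?W) (\<lambda>z. G (z (mdim S)))"
      by (rule holo_last_coordinate) (assumption, rule last)
    then show ?thesis
      by (rule holo_transform[OF openin_coords[OF M \<alpha> W]]) (use True \<alpha> in \<open>auto simp: rothstein_scalar_def\<close>)
  next
    case False
    then show ?thesis by (simp add: rothstein_scalar_def holo_def)
  qed
  moreover have "?s \<alpha> z = pullback (Suc (mdim S)) (mrank S)
      (rothstein_transition (mdim S) (rho S \<alpha> \<beta>)) (?s \<beta>) z"
    if \<alpha>: "\<alpha> \<in> mindex S" and \<beta>: "\<beta> \<in> mindex S"
      and z: "z \<in> coords S \<alpha> (?W \<inter> patch S \<beta> \<times> UNIV)" for \<alpha> \<beta> z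
  proof -
    have "pullback (Suc (mdim S)) (mrank S) (rothstein_transition (mdim S) (rho S \<alpha> \<beta>)) (?s \<beta>) z =
        (\<lambda>J. if J = {} then G (z (mdim S)) else 0)"
      by (rule pullback_rothstein_scalar[OF openin_coords[OF M \<beta> W]
            body_rothstein_in_coords[OF S \<alpha> \<beta> z]]) (use \<beta> in \<open>auto simp: rothstein_scalar_def\<close>)
    moreover have "z \<in> coords S \<alpha> ?W" using z coords_mono[of _ ?W S \<alpha>] by blast
    ultimately show ?thesis using \<alpha> by (auto simp: rothstein_scalar_def)
  qed
  ultimately show ?thesis
    by (auto simp: rothstein_sections_def superholo_def rothstein_scalar_def)
qed


section \<open>Gluing over the projective line\<close>

lemma hpoint_inverse:
  assumes "t \<noteq> 0"
  shows "hpoint (inverse t) 1 = hpoint 1 t"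
proof -
  have "\<exists>c'. c' \<noteq> 0 \<and> c * inverse t = c' \<and> c = c' * t" if "c \<noteq> 0" for c
    using assms that by (intro exI[of _ "c * inverse t"]) auto
  moreover have "\<exists>c'. c' \<noteq> 0 \<and> c = c' * inverse t \<and> c * t = c'" if "c \<noteq> 0" for c
    using assms that by (intro exI[of _ "c * t"]) auto
  ultimately show ?thesis by (fastforce simp: hpoint_def)
qed

lemma P1_param_swap:
  assumes "i \<in> {1, 2}" "j \<in> {1, 2}" "i \<noteq> j" "t \<noteq> 0"
  shows "P1_param j (inverse t) = P1_param i t"
  using assms hpoint_inverse[of t] hpoint_inverse[of "inverse t"]
  by (auto simp: P1_param_def)

lemma hpoint_mem: "(a, b) \<in> hpoint a b"
  by (auto simp: hpoint_def intro!: exI[of _ 1])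

lemma hpoint_1_neq: "hpoint 1 0 \<noteq> hpoint t 1" "hpoint 0 1 \<noteq> hpoint 1 t"
  using hpoint_mem[of 1 0] hpoint_mem[of 0 1] by (auto simp: hpoint_def)

text \<open>Each coordinate origin lies in one patch only. The index \<open>i\<close> may be
  arbitrary since \<open>P1_param\<close> treats every index other than 1 as the second
  coordinate.\<close>

lemma P1_param_in_both: "P1_param i t \<in> P1_patch 1 \<inter> P1_patch 2 \<longleftrightarrow> t \<noteq> 0"
proof
  assume "P1_param i t \<in> P1_patch 1 \<inter> P1_patch 2"
  then show "t \<noteq> 0"
    using hpoint_1_neq by (cases "i = 1") (auto simp: P1_patch_def P1_param_def)
next
  assume "t \<noteq> 0"
  then have "P1_param 1 t \<in> P1_patch 2" "P1_param 2 t \<in> P1_patch 1"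
    using P1_param_swap[of 1 2 t] P1_param_swap[of 2 1 t] by (auto simp: P1_patch_def)
  then show "P1_param i t \<in> P1_patch 1 \<inter> P1_patch 2"
    by (cases "i = 1") (auto simp: P1_patch_def P1_param_def)
qed

lemma P1_param_in_points: "P1_param i t \<in> P1_points"
  using zero_neq_one unfolding P1_points_def P1_param_def by fastforce

lemma P1_patch_cover: "P1_patch 1 \<union> P1_patch 2 = P1_points"
proof
  show "P1_points \<subseteq> P1_patch 1 \<union> P1_patch 2"
  proof
    fix p assume "p \<in> P1_points"
    then obtain a b where p: "p = hpoint a b" "(a, b) \<noteq> (0, 0)" by (auto simp: P1_points_def)
    show "p \<in> P1_patch 1 \<union> P1_patch 2"
    proof (cases "a = 0")
      case False
      have "\<exists>c'. c' \<noteq> 0 \<and> c * a = c' \<and> c * b = c' * (b / a)" if "c \<noteq> 0" for c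
        using False that by auto
      moreover have "\<exists>c'. c' \<noteq> 0 \<and> c = c' * a \<and> c * (b / a) = c' * b" if "c \<noteq> 0" for c
        using False that by (intro exI[of _ "c / a"]) auto
      ultimately have "p = P1_param 1 (b / a)"
        unfolding p P1_param_def hpoint_def by fastforce
      then show ?thesis by (auto simp: P1_patch_def)
    next
      case True
      then have b: "b \<noteq> 0" using p by auto
      have "\<exists>c'. c' \<noteq> 0 \<and> c = c' * b" if "c \<noteq> 0" for c
        using b that by (intro exI[of _ "c / b"]) auto
      then have "p = P1_param 2 0"
        unfolding p P1_param_def hpoint_def using b True by fastforce
      then show ?thesis by (auto simp: P1_patch_def)
    qed
  qed
qed (auto simp: P1_patch_def P1_param_in_points)

lemma P1_open_patch:
  assumes i: "i \<in> {1, 2}"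
  shows "P1_open (P1_patch i)"
  unfolding P1_open_def
proof (intro conjI ballI)
  show "P1_patch i \<subseteq> P1_points" by (auto simp: P1_patch_def P1_param_in_points)
  fix k :: nat assume k: "k \<in> {1, 2}"
  show "open (P1_param k -` P1_patch i)"
  proof (cases "k = i")
    case True
    then have "P1_param k -` P1_patch i = UNIV" by (auto simp: P1_patch_def)
    then show ?thesis by simp
  next
    case False
    then have "P1_param k t \<in> P1_patch i \<longleftrightarrow> P1_param k t \<in> P1_patch 1 \<inter> P1_patch 2" for t
      using i k by (auto simp: P1_patch_def)
    then have "P1_param k -` P1_patch i = - {0}"
      unfolding P1_param_in_both by auto
    then show ?thesis by (simp add: open_Compl)
  qed
qed

lemma openin_P1: "openin (stop P1) = P1_open"
  by (simp add: P1_def function_space_def topology_inverse' istopology_P1_open)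

lemma topspace_P1: "topspace (stop P1) = P1_points"
proof -
  have "P1_param i -` P1_points = UNIV" for i
    using P1_param_in_points by auto
  then have "P1_open P1_points" by (auto simp: P1_open_def)
  then show ?thesis unfolding topspace_def openin_P1 by (auto simp: P1_open_def)
qed

lemma openin_open_sub_P1:
  "P1_open A \<Longrightarrow> openin (stop (open_sub P1 A)) V \<longleftrightarrow> P1_open V \<and> V \<subseteq> A"
  by (simp add: open_sub_def openin_P1 openin_open_subtopology)

section \<open>The projection of the family to the projective line\<close>

lemma stop_rothstein_space: "stop (rothstein_space S) = prod_topology (mspace S) euclidean"
  by (simp add: rothstein_space_def)

lemma smap_rothstein_over: "smap (rothstein_over S i) = (\<lambda>q. P1_param i (snd q))"
  by (auto simp: rothstein_over_def scomp_def P1_incl_def rothstein_proj_def)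

lemma spull_rothstein_over:
  "spull (rothstein_over S i) V g =
     rothstein_scalar S (topspace (mspace S) \<times> P1_param i -` V) (g \<circ> P1_param i)"
  by (simp add: rothstein_over_def scomp_def P1_incl_def rothstein_proj_def spre_def
      affine_line_def function_space_def vimage_def)

lemma spre_rothstein_over:
  "spre (rothstein_space S) (rothstein_over S i) V = topspace (mspace S) \<times> P1_param i -` V"
  by (auto simp: spre_def smap_rothstein_over stop_rothstein_space)

lemma coords_Times: "z \<in> coords S \<alpha> (X \<times> U) \<Longrightarrow> z (mdim S) \<in> U"
  by (auto elim!: coordsE)

lemma rothstein_scalar_mult:
  "rothstein_scalar S W (\<lambda>t. f t * g t) =
    (\<lambda>\<alpha> z. gmult (rothstein_scalar S W f \<alpha> z) (rothstein_scalar S W g \<alpha> z))"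
  by (intro ext) (subst gmult_scalar; auto simp: rothstein_scalar_def)

text \<open>A function on the base becomes a section of degree 0 in theta, so products and parity
  are inherited; the only odd function on the base is 0.\<close>

lemma is_morphism_rothstein_over:
  assumes S: "is_supermanifold j S" and i: "i \<in> {1, 2}"
  shows "is_morphism (rothstein_space S) (open_sub P1 (P1_patch i)) (rothstein_over S i)"
  unfolding is_morphism_def
proof (intro conjI allI ballI impI)
  let ?T = "open_sub P1 (P1_patch i)" and ?R = "rothstein_space S" and ?f = "rothstein_over S i"
  let ?X = "topspace (mspace S)"
  note op = openin_open_sub_P1[OF P1_open_patch[OF i]]
  have pre: "open (P1_param i -` V)" if "openin (stop ?T) V" for V
    using that i by (auto simp: op P1_open_def)
  show "continuous_map (stop ?R) (stop ?T) (smap ?f)"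
  proof -
    have "continuous_map euclidean (stop ?T) (P1_param i)"
      unfolding continuous_map_def
    proof (intro conjI allI impI)
      show "P1_param i \<in> topspace euclidean \<rightarrow> topspace (stop ?T)"
        using P1_param_in_points by (auto simp: open_sub_def topspace_P1 P1_patch_def)
      show "openin euclidean {x \<in> topspace euclidean. P1_param i x \<in> U}" if "openin (stop ?T) U" for U
        using pre[OF that] by (simp add: vimage_def)
    qed
    from continuous_map_compose[OF continuous_map_snd this] show ?thesis
      by (simp add: stop_rothstein_space smap_rothstein_over o_def)
  qed
  fix V assume V: "openin (stop ?T) V"
  define U where "U = P1_param i -` V"
  have U: "open U" using pre[OF V] by (simp add: U_def)
  have spre: "spre ?R ?f V = ?X \<times> U" and
    spull: "spull ?f V g = rothstein_scalar S (?X \<times> U) (g \<circ> P1_param i)" for g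
    by (simp_all add: spre_rothstein_over spull_rothstein_over U_def)
  have hol: "(g \<circ> P1_param i) holomorphic_on U" if "g \<in> carrier (ssec ?T V)" for g
    using that i by (auto simp: open_sub_def P1_def function_space_def fun_alg_def U_def)
  have sec: "spull ?f V g \<in> rothstein_sections S (?X \<times> U)" if "g \<in> carrier (ssec ?T V)" for g
    unfolding spull by (rule rothstein_scalar_in_sections[OF S U hol[OF that]])
  show "spull ?f V \<in> ring_hom (ssec ?T V) (ssec ?R (spre ?R ?f V))"
  proof (rule ring_hom_memI)
    show "spull ?f V g \<in> carrier (ssec ?R (spre ?R ?f V))" if "g \<in> carrier (ssec ?T V)" for g
      using sec[OF that] unfolding spre by (simp add: rothstein_space_def rothstein_alg_def)
    show "spull ?f V (g \<otimes>\<^bsub>ssec ?T V\<^esub> h) =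
        spull ?f V g \<otimes>\<^bsub>ssec ?R (spre ?R ?f V)\<^esub> spull ?f V h" for g h
      by (simp add: spull rothstein_space_def rothstein_alg_def open_sub_def P1_def
          function_space_def fun_alg_def o_def rothstein_scalar_mult)
    show "spull ?f V (g \<oplus>\<^bsub>ssec ?T V\<^esub> h) =
        spull ?f V g \<oplus>\<^bsub>ssec ?R (spre ?R ?f V)\<^esub> spull ?f V h" for g h
      by (auto simp: spull rothstein_space_def rothstein_alg_def open_sub_def P1_def
          function_space_def fun_alg_def o_def rothstein_scalar_def intro!: ext)
    \<comment> \<open>The unit on the base is the indicator of \<open>V\<close>. It pulls back to
      the unit because the last coordinate of a point over \<open>V\<close> lies in
      \<open>U\<close>.\<close>
    show "spull ?f V \<one>\<^bsub>ssec ?T V\<^esub> = \<one>\<^bsub>ssec ?R (spre ?R ?f V)\<^esub>"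
      unfolding spre
      by (auto simp: spull rothstein_space_def rothstein_alg_def open_sub_def P1_def
          function_space_def fun_alg_def o_def rothstein_scalar_def U_def
          dest!: coords_Times intro!: ext)
  qed
  show "spull ?f V (c \<odot>\<^bsub>ssec ?T V\<^esub> s) = c \<odot>\<^bsub>ssec ?R (spre ?R ?f V)\<^esub> spull ?f V s"
    if "s \<in> carrier (ssec ?T V)" for c s
    by (auto simp: spull rothstein_space_def rothstein_alg_def open_sub_def P1_def
        function_space_def fun_alg_def o_def rothstein_scalar_def intro!: ext)
  show "spull ?f V ` seven ?T V \<subseteq> seven ?R (spre ?R ?f V)"
  proof
    fix s assume "s \<in> spull ?f V ` seven ?T V"
    then obtain g where g: "g \<in> seven ?T V" and s: "s = spull ?f V g" by blast
    have "g \<in> carrier (ssec ?T V)"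
      using g by (simp add: open_sub_def P1_def function_space_def fun_alg_def)
    from sec[OF this] show "s \<in> seven ?R (spre ?R ?f V)"
      unfolding s spre by (auto simp: rothstein_space_def spull rothstein_scalar_def)
  qed
  show "spull ?f V ` sodd ?T V \<subseteq> sodd ?R (spre ?R ?f V)"
  proof
    fix s assume "s \<in> spull ?f V ` sodd ?T V"
    then have s: "s = spull ?f V (\<lambda>p. 0)"
      by (auto simp: open_sub_def P1_def function_space_def)
    have "(\<lambda>p. 0) \<in> carrier (ssec ?T V)"
      by (auto simp: open_sub_def P1_def function_space_def fun_alg_def o_def)
    from sec[OF this] show "s \<in> sodd ?R (spre ?R ?f V)"
      unfolding s spre by (auto simp: rothstein_space_def spull rothstein_scalar_def)
  qed
  show "spull ?f V' (sres ?T V V' s) = sres ?R (spre ?R ?f V) (spre ?R ?f V') (spull ?f V s)"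
    if "openin (stop ?T) V' \<and> V' \<subseteq> V \<and> s \<in> carrier (ssec ?T V)" for V' s
  proof (intro ext)
    fix \<alpha> z J
    have "?X \<times> P1_param i -` V' \<subseteq> ?X \<times> U" using that by (auto simp: U_def)
    note sub = coords_mono[OF this, of S \<alpha>]
    show "spull ?f V' (sres ?T V V' s) \<alpha> z J =
        sres ?R (spre ?R ?f V) (spre ?R ?f V') (spull ?f V s) \<alpha> z J"
      using sub unfolding spre_rothstein_over spull_rothstein_over U_def
      by (auto simp: rothstein_space_def open_sub_def P1_def function_space_def rothstein_scalar_def dest: coords_Times)
  qed
qed

section \<open>Identity and inversion as gluing isomorphisms\<close>

lemma is_isomorphism_sid: "is_isomorphism Y Y sid"
proof -
  have spre: "spre Y sid V = V" if "openin (stop Y) V" for V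
    using openin_subset[OF that] by (auto simp: spre_def sid_def)
  have "homeomorphic_map (stop Y) (stop Y) (smap sid)"
    by (simp add: sid_def homeomorphic_map_id)
  moreover have "spull sid V \<in> ring_iso (ssec Y V) (ssec Y (spre Y sid V))" if "openin (stop Y) V" for V
    unfolding spre[OF that] by (auto simp: sid_def intro!: ring_iso_memI)
  ultimately show ?thesis
    unfolding is_isomorphism_def is_morphism_def
    by (auto simp: spre ring_iso_def homeomorphic_imp_continuous_map) (simp_all add: sid_def)
qed

definition invert_morph ::
  "('p, 'i, 'z) supermanifold_scheme
     \<Rightarrow> ('p \<times> complex, 'i sections, 'p \<times> complex, 'i sections) smorph" where
  "invert_morph S = \<lparr> smap = (\<lambda>q. (fst q, inverse (snd q))), spull = invert_pull S \<rparr>"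

abbreviation punctured where
  "punctured S \<equiv> open_sub (rothstein_space S) (topspace (mspace S) \<times> - {0})"

text \<open>Restricted to the overlap, both families are literally the same space, so one self-map
  can serve as gluing map in both directions.\<close>

lemma over_rothstein_punctured:
  assumes "A = P1_patch 1 \<inter> P1_patch 2"
  shows "over (rothstein_space S) (rothstein_over S i) A = punctured S"
proof -
  have "P1_param i -` A = - {0}" using P1_param_in_both assms by auto
  then show ?thesis by (simp add: over_def spre_rothstein_over)
qed

lemma stop_punctured:
  "stop (punctured S) = subtopology (prod_topology (mspace S) euclidean) (topspace (mspace S) \<times> - {0})"
  by (simp add: open_sub_def stop_rothstein_space)

lemma topspace_punctured: "topspace (stop (punctured S)) = topspace (mspace S) \<times> - {0}"
  by (auto simp: stop_punctured)

lemma openin_punctured: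
  "openin (stop (punctured S)) V \<longleftrightarrow>
     openin (prod_topology (mspace S) euclidean) V \<and> V \<subseteq> topspace (mspace S) \<times> - {0}"
proof -
  have "openin (prod_topology (mspace S) euclidean) (topspace (mspace S) \<times> - {0 :: complex})"
    by (simp add: openin_prod_Times_iff open_Compl)
  then show ?thesis by (simp add: stop_punctured openin_open_subtopology)
qed

lemma spre_invert_morph:
  "V \<subseteq> topspace (mspace S) \<times> - {0} \<Longrightarrow> spre (punctured S) (invert_morph S) V = invert V"
  by (auto simp: spre_def topspace_punctured invert_morph_def invert_def)

text \<open>The map is its own inverse on points, so continuity already gives a homeomorphism. On
  sections the inverse is the same formula taken over \<open>invert V\<close>.\<close>

lemma is_isomorphism_invert_morph:
  assumes S: "is_supermanifold j S"
  shows "is_isomorphism (punctured S) (punctured S) (invert_morph S)"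
proof -
  let ?R = "punctured S" and ?f = "invert_morph S"
  let ?T = "prod_topology (mspace S) (euclidean :: complex topology)"
  have ssec: "ssec ?R = rothstein_alg S" by (simp add: open_sub_def rothstein_space_def)
  have snd: "continuous_map (stop ?R) (top_of_set (- {0})) snd"
    by (auto simp: stop_punctured continuous_map_in_subtopology
        intro: continuous_map_from_subtopology continuous_map_snd)
  have inv: "continuous_map (top_of_set (- {0 :: complex})) euclidean inverse"
    by (auto intro!: continuous_intros)
  have "continuous_map (stop ?R) ?T (smap ?f)"
    using continuous_map_compose[OF snd inv] unfolding stop_punctured
    by (auto simp: invert_morph_def o_def intro!: continuous_map_pairedI
        intro: continuous_map_from_subtopology continuous_map_fst)
  then have cont: "continuous_map (stop ?R) (stop ?R) (smap ?f)"
    by (subst (2) stop_punctured) (auto simp: continuous_map_in_subtopology topspace_punctured invert_morph_def)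
  have "homeomorphic_maps (stop ?R) (stop ?R) (smap ?f) (smap ?f)"
    using cont by (auto simp: homeomorphic_maps_def invert_morph_def)
  then have hom: "homeomorphic_map (stop ?R) (stop ?R) (smap ?f)"
    using homeomorphic_maps_map by blast
  have main: "spull ?f V \<in> ring_iso (ssec ?R V) (ssec ?R (spre ?R ?f V)) \<and>
      (\<forall>c. \<forall>s\<in>carrier (ssec ?R V).
           spull ?f V (c \<odot>\<^bsub>ssec ?R V\<^esub> s) = c \<odot>\<^bsub>ssec ?R (spre ?R ?f V)\<^esub> spull ?f V s) \<and>
      spull ?f V ` seven ?R V \<subseteq> seven ?R (spre ?R ?f V) \<and>
      spull ?f V ` sodd ?R V \<subseteq> sodd ?R (spre ?R ?f V) \<and>
      (\<forall>V' s. openin (stop ?R) V' \<and> V' \<subseteq> V \<and> s \<in> carrier (ssec ?R V) \<longrightarrow>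
           spull ?f V' (sres ?R V V' s) = sres ?R (spre ?R ?f V) (spre ?R ?f V') (spull ?f V s))"
    if "openin (stop ?R) V" for V
  proof -
    have V: "openin ?T V" and Vsub: "V \<subseteq> topspace (mspace S) \<times> - {0}"
      using that by (auto simp: openin_punctured)
    have Vsub': "V \<subseteq> UNIV \<times> - {0}" "invert V \<subseteq> UNIV \<times> - {0}"
      using Vsub by (auto simp: invert_def)
    note spre = spre_invert_morph[OF Vsub]
    have spull: "spull ?f = invert_pull S" by (simp add: invert_morph_def)
    have bij: "bij_betw (invert_pull S V) (rothstein_sections S V) (rothstein_sections S (invert V))"
    proof (rule bij_betw_byWitness[where f' = "invert_pull S (invert V)"])
      show "\<forall>s\<in>rothstein_sections S V. invert_pull S (invert V) (invert_pull S V s) = s"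
        using invert_pull_invert_pull[OF Vsub'(1)] by blast
      show "\<forall>s\<in>rothstein_sections S (invert V). invert_pull S V (invert_pull S (invert V) s) = s"
        using invert_pull_invert_pull[OF Vsub'(2), of _ S] by (simp add: invert_invert[OF Vsub'(1)])
      show "invert_pull S V ` rothstein_sections S V \<subseteq> rothstein_sections S (invert V)"
        using invert_pull_in_sections[OF S V] by blast
      show "invert_pull S (invert V) ` rothstein_sections S (invert V) \<subseteq> rothstein_sections S V"
        using invert_pull_in_sections[OF S openin_invert[OF V]] by (auto simp: invert_invert[OF Vsub'(1)])
    qed
    have iso: "invert_pull S V \<in> ring_iso (rothstein_alg S V) (rothstein_alg S (invert V))"
    proof (rule ring_iso_memI)
      show "invert_pull S V s \<in> carrier (rothstein_alg S (invert V))"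
        if "s \<in> carrier (rothstein_alg S V)" for s
        using that invert_pull_in_sections[OF S V] by (simp add: rothstein_alg_def)
      show "invert_pull S V (s \<otimes>\<^bsub>rothstein_alg S V\<^esub> s') =
          invert_pull S V s \<otimes>\<^bsub>rothstein_alg S (invert V)\<^esub> invert_pull S V s'" for s s'
      proof (intro ext)
        fix \<alpha> z J
        show "invert_pull S V (s \<otimes>\<^bsub>rothstein_alg S V\<^esub> s') \<alpha> z J =
            (invert_pull S V s \<otimes>\<^bsub>rothstein_alg S (invert V)\<^esub> invert_pull S V s') \<alpha> z J"
          by (cases "z \<in> coords S \<alpha> (invert V)")
             (simp_all add: rothstein_alg_def invert_pull_def gscale_gmult gmult_zero_left)
      qed
      show "invert_pull S V (s \<oplus>\<^bsub>rothstein_alg S V\<^esub> s') =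
          invert_pull S V s \<oplus>\<^bsub>rothstein_alg S (invert V)\<^esub> invert_pull S V s'" for s s'
        by (auto simp: rothstein_alg_def invert_pull_def gscale_def algebra_simps intro!: ext)
      show "invert_pull S V \<one>\<^bsub>rothstein_alg S V\<^esub> = \<one>\<^bsub>rothstein_alg S (invert V)\<^esub>"
        by (auto simp: rothstein_alg_def invert_pull_def gscale_def rothstein_scalar_def
            coords_invert intro!: ext)
      show "bij_betw (invert_pull S V) (carrier (rothstein_alg S V)) (carrier (rothstein_alg S (invert V)))"
        using bij by (simp add: rothstein_alg_def)
    qed
    have smult: "invert_pull S V (c \<odot>\<^bsub>rothstein_alg S V\<^esub> s) =
        c \<odot>\<^bsub>rothstein_alg S (invert V)\<^esub> invert_pull S V s" for c s
      by (auto simp: rothstein_alg_def invert_pull_def gscale_def intro!: ext)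
    have parity: "invert_pull S V ` seven ?R V \<subseteq> seven ?R (invert V)"
      "invert_pull S V ` sodd ?R V \<subseteq> sodd ?R (invert V)"
      using invert_pull_in_sections[OF S V]
      by (auto simp: open_sub_def rothstein_space_def invert_pull_def gscale_def)
    have res: "invert_pull S V' (sres ?R V V' s) = sres ?R (invert V) (invert V') (invert_pull S V s)"
      if "V' \<subseteq> V" for V' s
    proof (intro ext)
      fix \<alpha> z J
      have "coords S \<alpha> (invert V') \<subseteq> coords S \<alpha> (invert V)"
        using that by (intro coords_mono) (auto simp: invert_def)
      then show "invert_pull S V' (sres ?R V V' s) \<alpha> z J =
          sres ?R (invert V) (invert V') (invert_pull S V s) \<alpha> z J"
        by (auto simp: open_sub_def rothstein_space_def invert_pull_def gscale_def coords_invert)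
    qed
    show ?thesis
      using iso smult parity res
      by (auto simp: ssec spre spull spre_invert_morph openin_punctured)
  qed
  show ?thesis
    unfolding is_isomorphism_def is_morphism_def
    using cont hom main by (auto simp: ring_iso_def)
qed

lemma scomp_sid_right: "scomp T f sid = f"
  by (cases f) (simp add: scomp_def sid_def)

lemma iso_over_sid: "iso_over B A Y \<pi> Y \<pi> sid"
  by (simp add: iso_over_def is_isomorphism_sid scomp_sid_right eq_morphism_def)

text \<open>Unlike \<open>scomp_sid_right\<close> this is no equation of records: the composite
  evaluates the pullback of \<open>f\<close> at \<open>spre T sid V\<close>, which is
  \<open>V\<close> only for \<open>V\<close> inside the space.\<close>

lemma eq_morphism_sid_left: "eq_morphism Y T f (scomp T sid f)"
proof -
  have "spre T sid V = V" if "openin (stop T) V" for V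
    using openin_subset[OF that] by (auto simp: spre_def sid_def)
  then show ?thesis by (auto simp: eq_morphism_def scomp_def) (simp_all add: sid_def)
qed

text \<open>On points, \<open>1/t\<close> in one coordinate names the same point of the base as
  \<open>t\<close> in the other. On functions from the base only the degree 0 coefficient is
  present, which the scaling by \<open>t^2\<close> leaves alone.\<close>

lemma iso_over_invert_morph:
  assumes S: "is_supermanifold j S" and i: "i \<in> {1, 2}" "k \<in> {1, 2}" "i \<noteq> k"
    and A: "A = P1_patch 1 \<inter> P1_patch 2"
  shows "iso_over P1 A (rothstein_space S) (rothstein_over S i)
    (rothstein_space S) (rothstein_over S k) (invert_morph S)"
  unfolding iso_over_def over_rothstein_punctured[OF A]
proof
  let ?X = "topspace (mspace S)"
  show "is_isomorphism (punctured S) (punctured S) (invert_morph S)"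
    by (rule is_isomorphism_invert_morph[OF S])
  show "eq_morphism (punctured S) (open_sub P1 A)
      (scomp (punctured S) (rothstein_over S k) (invert_morph S)) (rothstein_over S i)"
    unfolding eq_morphism_def
  proof (intro conjI ballI allI impI)
    show "smap (scomp (punctured S) (rothstein_over S k) (invert_morph S)) q = smap (rothstein_over S i) q"
      if "q \<in> topspace (stop (punctured S))" for q
      using that P1_param_swap[OF i]
      by (auto simp: topspace_punctured scomp_def smap_rothstein_over invert_morph_def)
    fix V g assume "openin (stop (open_sub P1 A)) V"
    then have VA: "V \<subseteq> A" by (auto simp: open_sub_def dest!: openin_subset)
    have nz: "t \<noteq> 0" if "P1_param l t \<in> V" for l t
      using that VA A P1_param_in_both by blast
    \<comment> \<open>\<open>V\<close> lies in the overlap, so its preimage avoids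
      \<open>t = 0\<close> and nothing is lost by passing to the punctured part.\<close>
    have pre: "spre (punctured S) (rothstein_over S k) V = ?X \<times> P1_param k -` V"
      using nz by (auto simp: spre_def topspace_punctured smap_rothstein_over)
    have inv: "invert (?X \<times> P1_param k -` V) = ?X \<times> P1_param i -` V"
      using nz P1_param_swap[OF i] by (auto simp: invert_def)
    have "invert_pull S (?X \<times> P1_param k -` V)
        (rothstein_scalar S (?X \<times> P1_param k -` V) (g \<circ> P1_param k)) \<alpha> z J =
        rothstein_scalar S (?X \<times> P1_param i -` V) (g \<circ> P1_param i) \<alpha> z J" for \<alpha> z J
    proof (cases "z \<in> coords S \<alpha> (?X \<times> P1_param i -` V)")
      case True
      then have "z (mdim S) \<noteq> 0"
          "z(mdim S := inverse (z (mdim S))) \<in> coords S \<alpha> (?X \<times> P1_param k -` V)"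
        unfolding inv[symmetric] coords_invert by auto
      then show ?thesis
        using True P1_param_swap[OF i] by (auto simp: invert_pull_def inv rothstein_scalar_def gscale_def)
    next
      case False
      then show ?thesis by (simp add: invert_pull_def inv rothstein_scalar_def)
    qed
    then show "spull (scomp (punctured S) (rothstein_over S k) (invert_morph S)) V g =
        spull (rothstein_over S i) V g"
      by (auto simp: scomp_def pre spull_rothstein_over invert_morph_def intro!: ext)
  qed
qed

lemma eq_morphism_invert_invert:
  "eq_morphism (punctured S) (punctured S) sid
    (scomp (punctured S) (invert_morph S) (invert_morph S))"
  unfolding eq_morphism_def
proof (intro conjI ballI allI impI)
  show "smap sid q = smap (scomp (punctured S) (invert_morph S) (invert_morph S)) q" for q
    by (simp add: sid_def scomp_def invert_morph_def)
  fix V s assume V: "openin (stop (punctured S)) V" and s: "s \<in> carrier (ssec (punctured S) V)"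
  then have sub: "V \<subseteq> topspace (mspace S) \<times> - {0}" by (simp add: openin_punctured)
  then have "V \<subseteq> UNIV \<times> - {0}" by auto
  moreover have "s \<in> rothstein_sections S V"
    using s by (simp add: open_sub_def rothstein_space_def rothstein_alg_def)
  ultimately have "invert_pull S (invert V) (invert_pull S V s) = s"
    by (rule invert_pull_invert_pull)
  then show "spull sid V s = spull (scomp (punctured S) (invert_morph S) (invert_morph S)) V s"
    using spre_invert_morph[OF sub] by (simp add: sid_def scomp_def) (simp add: invert_morph_def)
qed

theorem theorem1p5p8:
  fixes x :: "('p, 'i) supermanifold" and j :: nat
  assumes "j > 1" and "is_supermanifold j x"
  shows "will_glue P1 {1, 2} P1_patch (\<lambda>i. rothstein_space x) (rothstein_over x)"
  unfolding will_glue_def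
proof (intro conjI exI)
  let ?\<theta> = "\<lambda>i k :: nat. if i = k then sid else invert_morph x"
  show "\<forall>i\<in>{1, 2}. openin (stop P1) (P1_patch i)"
    using P1_open_patch by (simp add: openin_P1)
  show "(\<Union>i\<in>{1, 2}. P1_patch i) = topspace (stop P1)"
    using P1_patch_cover by (simp add: topspace_P1)
  show "\<forall>i\<in>{1, 2}. is_morphism (rothstein_space x) (open_sub P1 (P1_patch i)) (rothstein_over x i)"
    using is_morphism_rothstein_over[OF assms(2)] by blast
  show "\<forall>i\<in>{1, 2}. \<forall>k\<in>{1, 2}. P1_patch i \<inter> P1_patch k \<noteq> {} \<longrightarrow>
      iso_over P1 (P1_patch i \<inter> P1_patch k) (rothstein_space x) (rothstein_over x i)
        (rothstein_space x) (rothstein_over x k) (?\<theta> i k)"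
  proof (intro ballI impI)
    fix i k :: nat assume "i \<in> {1, 2}" "k \<in> {1, 2}"
    then show "iso_over P1 (P1_patch i \<inter> P1_patch k) (rothstein_space x) (rothstein_over x i)
        (rothstein_space x) (rothstein_over x k) (?\<theta> i k)"
      using iso_over_sid iso_over_invert_morph[OF assms(2), of i k "P1_patch i \<inter> P1_patch k"]
      by (cases "i = k") (auto simp: Int_commute)
  qed
  show "\<forall>i\<in>{1, 2}. eq_morphism (rothstein_space x) (rothstein_space x) (?\<theta> i i) sid"
    by (simp add: eq_morphism_def)
  show "\<forall>i\<in>{1, 2}. \<forall>k\<in>{1, 2}. \<forall>l\<in>{1, 2}. P1_patch i \<inter> P1_patch k \<inter> P1_patch l \<noteq> {} \<longrightarrow>
      eq_morphism (over (rothstein_space x) (rothstein_over x i) (P1_patch i \<inter> P1_patch k \<inter> P1_patch l))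
        (over (rothstein_space x) (rothstein_over x l) (P1_patch i \<inter> P1_patch k \<inter> P1_patch l))
        (?\<theta> i l)
        (scomp (over (rothstein_space x) (rothstein_over x k) (P1_patch i \<inter> P1_patch k \<inter> P1_patch l))
          (?\<theta> k l) (?\<theta> i k))"
  proof (intro ballI impI)
    fix i k l :: nat assume ikl: "i \<in> {1, 2}" "k \<in> {1, 2}" "l \<in> {1, 2}"
    let ?A = "P1_patch i \<inter> P1_patch k \<inter> P1_patch l"
    \<comment> \<open>The first two cases are unit laws for \<open>sid\<close>. In the third, having
      only two indices forces \<open>i = l\<close>.\<close>
    consider "i = k" | "k = l" | "i \<noteq> k" "k \<noteq> l" by blast
    then show "eq_morphism (over (rothstein_space x) (rothstein_over x i) ?A)
        (over (rothstein_space x) (rothstein_over x l) ?A) (?\<theta> i l)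
        (scomp (over (rothstein_space x) (rothstein_over x k) ?A) (?\<theta> k l) (?\<theta> i k))"
    proof cases
      case 1
      then show ?thesis by (simp add: scomp_sid_right eq_morphism_def)
    next
      case 2
      then show ?thesis by (simp add: eq_morphism_sid_left)
    next
      case 3
      then have "?A = P1_patch 1 \<inter> P1_patch 2" and "i = l" using ikl by auto
      then show ?thesis
        using 3 eq_morphism_invert_invert by (simp add: over_rothstein_punctured)
    qed
  qed
qed

end
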